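(* Let $M$ be a closed PL manifold of dimension $d$ with a free simplicial involution $A$. Then $(M,A)$ is a BUT manifold if and only if for every equivariant triangulation $T$ of $M$ and every labelling $L:V(T)\to\{+1,-1,+2,-2,\ldots,+d,-d\}$ satisfying $L(A(v))=-L(v)$ for all $v\in V(T)$, there exists an edge $uv$ of $T$ with $L(u)=-L(v)$.
   Context: A free involution on $M$ is a map $A:M\to M$ with $A(A(x))=x$ and $A(x)\ne x$ for all $x$; it is simplicial if it is simplicial with respect to some triangulation. A triangulation $T$ of $M$ is equivariant (antipodal) if $A$ maps it simplicially onto itself. $(M,A)$ is a BUT (Borsuk–Ulam type) manifold if for every continuous $g:M\to\mathbb{R}^d$ there is $x\in M$ with $g(A(x))=g(x)$ (equivalently, every continuous $f:M\to\mathbb{R}^d$ with $f(A(x))=-f(x)$ has a zero). $V(T)$ denotes the vertex set of $T$. *)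

theory Defs
  imports "HOL-Analysis.Analysis"
begin

text \<open>
  PL topology is set up in the classical way, with polyhedra in Euclidean spaces: a PL manifold
  is a subset of some Euclidean space that is locally PL homeomorphic to open subsets of
  \<open>\<real>\<^sup>d\<close>, and a triangulation is a PL homeomorphism from the underlying polyhedron of a
  simplicial complex. The complex may live in a different Euclidean space than the manifold;
  a complex of dimension \<open>d\<close> always embeds linearly in dimension \<open>2 * d + 1\<close>, so an ambient type of
  at least that dimension accommodates every triangulation up to isomorphism.
\<close>

definition affine_map_on :: "'a::real_vector set \<Rightarrow> ('a \<Rightarrow> 'b::real_vector) \<Rightarrow> bool" where
  "affine_map_on S f \<longleftrightarrow> (\<exists>g c. linear g \<and> (\<forall>x\<in>S. f x = g x + c))"

text \<open>
  Each point has a neighbourhood in \<open>S\<close> covered by finitely many polytopes contained in \<open>S\<close>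
  on each of which the map is affine. This forces \<open>S\<close> to be a (not necessarily compact)
  polyhedron.
\<close>

definition piecewise_linear_on :: "'a::euclidean_space set \<Rightarrow> ('a \<Rightarrow> 'b::euclidean_space) \<Rightarrow> bool" where
  "piecewise_linear_on S f \<longleftrightarrow>
     continuous_on S f \<and>
     (\<forall>x\<in>S. \<exists>U \<P>. openin (top_of_set S) U \<and> x \<in> U \<and>
        finite \<P> \<and> U \<subseteq> \<Union>\<P> \<and> \<Union>\<P> \<subseteq> S \<and>
        (\<forall>P\<in>\<P>. polytope P \<and> affine_map_on P f))"

definition pl_homeomorphism ::
    "'a::euclidean_space set \<Rightarrow> 'b::euclidean_space set \<Rightarrow> ('a \<Rightarrow> 'b) \<Rightarrow> bool" where
  "pl_homeomorphism S T f \<longleftrightarrow>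
     bij_betw f S T \<and> piecewise_linear_on S f \<and> piecewise_linear_on T (inv_into S f)"

text \<open>
  The model space \<open>\<real>\<^sup>d\<close> of a chart is a \<open>d\<close>-dimensional linear subspace \<open>E\<close> of the ambient
  space, so that \<open>d\<close> can be a natural number (including \<open>0\<close>) rather than a type. Requiring
  charts onto open subsets of \<open>E\<close> at all points excludes boundary points.
\<close>

definition pl_manifold :: "nat \<Rightarrow> 'a::euclidean_space set \<Rightarrow> bool" where
  "pl_manifold d M \<longleftrightarrow>
     (\<forall>x\<in>M. \<exists>U (E :: 'a set) V \<phi>.
        openin (top_of_set M) U \<and> x \<in> U \<and>
        subspace E \<and> dim E = d \<and> openin (top_of_set E) V \<and>
        pl_homeomorphism U V \<phi>)"

definition closed_pl_manifold :: "nat \<Rightarrow> 'a::euclidean_space set \<Rightarrow> bool" where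
  "closed_pl_manifold d M \<longleftrightarrow> compact M \<and> pl_manifold d M"

definition pl_triangulation ::
    "'b::euclidean_space set set \<Rightarrow> ('b \<Rightarrow> 'a::euclidean_space) \<Rightarrow> 'a set \<Rightarrow> bool" where
  "pl_triangulation K h M \<longleftrightarrow> simplicial_complex K \<and> pl_homeomorphism (\<Union>K) M h"

text \<open>
  Vertices and edges of the triangulation \<open>(K, h)\<close>, as points and pairs of points of the manifold.
\<close>

definition tri_vertices :: "'b::euclidean_space set set \<Rightarrow> ('b \<Rightarrow> 'a) \<Rightarrow> 'a set" where
  "tri_vertices K h = h ` {v. {v} \<in> K}"

definition tri_edge :: "'b::euclidean_space set set \<Rightarrow> ('b \<Rightarrow> 'a) \<Rightarrow> 'a \<Rightarrow> 'a \<Rightarrow> bool" where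
  "tri_edge K h u v \<longleftrightarrow>
     (\<exists>a b. a \<noteq> b \<and> closed_segment a b \<in> K \<and> u = h a \<and> v = h b)"

text \<open>Maps each simplex of \<open>K\<close> linearly onto a simplex of \<open>L\<close> (so vertices go to vertices).\<close>

definition simplicial_map ::
    "'a::euclidean_space set set \<Rightarrow> 'b::euclidean_space set set \<Rightarrow> ('a \<Rightarrow> 'b) \<Rightarrow> bool" where
  "simplicial_map K L f \<longleftrightarrow> (\<forall>S\<in>K. f ` S \<in> L \<and> affine_map_on S f)"

definition transport ::
    "'b::euclidean_space set set \<Rightarrow> ('b \<Rightarrow> 'a) \<Rightarrow> ('a \<Rightarrow> 'a) \<Rightarrow> 'b \<Rightarrow> 'b" where
  "transport K h A = inv_into (\<Union>K) h \<circ> A \<circ> h"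

definition simplicial_wrt ::
    "'b::euclidean_space set set \<Rightarrow> ('b \<Rightarrow> 'a) \<Rightarrow> ('a \<Rightarrow> 'a) \<Rightarrow> bool" where
  "simplicial_wrt K h A \<longleftrightarrow> simplicial_map K K (transport K h A)"

definition equivariant_triangulation ::
    "'b::euclidean_space set set \<Rightarrow> ('b \<Rightarrow> 'a::euclidean_space) \<Rightarrow> 'a set \<Rightarrow> ('a \<Rightarrow> 'a) \<Rightarrow> bool" where
  "equivariant_triangulation K h M A \<longleftrightarrow>
     pl_triangulation K h M \<and> simplicial_wrt K h A \<and>
     (\<lambda>S. transport K h A ` S) ` K = K"

definition free_involution :: "'a set \<Rightarrow> ('a \<Rightarrow> 'a) \<Rightarrow> bool" where
  "free_involution M A \<longleftrightarrow> (\<forall>x\<in>M. A x \<in> M \<and> A (A x) = x \<and> A x \<noteq> x)"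

definition but_manifold :: "nat \<Rightarrow> 'a::topological_space set \<Rightarrow> ('a \<Rightarrow> 'a) \<Rightarrow> bool" where
  "but_manifold d M A \<longleftrightarrow>
     (\<forall>g. continuous_map (top_of_set M) (Euclidean_space d) g \<longrightarrow> (\<exists>x\<in>M. g (A x) = g x))"

definition antipodal_labelling :: "nat \<Rightarrow> 'a set \<Rightarrow> ('a \<Rightarrow> 'a) \<Rightarrow> ('a \<Rightarrow> int) \<Rightarrow> bool" where
  "antipodal_labelling d V A L \<longleftrightarrow>
     L \<in> V \<rightarrow> {l. 1 \<le> \<bar>l\<bar> \<and> \<bar>l\<bar> \<le> int d} \<and> (\<forall>v\<in>V. L (A v) = - L v)"

end

theory Submission
  imports Defs
begin

text \<open>
  If a labelling has no complementary edge, send each vertex labelled \<open>\<plusminus>i\<close> to \<open>\<plusminus>e\<^sub>i\<close> and extend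
  linearly over the simplices. The image of each simplex lies in a face of the cross-polytope, so
  this is a nowhere vanishing odd map to \<open>\<real>\<^sup>d\<close>. Conversely, if \<open>g (A x) \<noteq> g x\<close> for all \<open>x\<close>, then by
  compactness some coordinate of the odd map \<open>f x = g x - g (A x)\<close> has absolute value at least a
  fixed \<open>\<delta> > 0\<close> at every point. Label each point by the first such coordinate, with its sign. The
  ends of a complementary edge have values of \<open>f\<close> that differ by \<open>2 * \<delta>\<close>, which is impossible in a
  sufficiently fine equivariant triangulation. Iterated barycentric subdivision of the given one
  is equivariant and arbitrarily fine.
\<close>

subsection \<open>Simplicial complexes as families of vertex sets\<close>

text \<open>The laborious point is that a barycentric subdivision is again a complex. Intersecting
  pairs of flags of simplices is avoided by treating a complex as a set of points with unique
  coordinates, so that the claim becomes one about functions. A point with coordinates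
  \<open>u\<close> on the vertices \<open>C\<close> lies in the subdivided simplex whose chain
  consists of superlevel sets of \<open>u\<close>: the decomposition of \<open>u\<close> into
  weighted indicators of a chain exists and is unique, and rescaling each indicator by the size of
  its set turns it into a barycenter.

  Only the complex is refined. The polyhedron and \<open>h\<close> stay fixed, so the refined
  triangulation inherits its PL homeomorphism and the transported involution is literally the same
  map. Accordingly fineness is measured in the polyhedron and not in \<open>M\<close>, and it is
  used through uniform continuity of the odd map composed with \<open>h\<close>.\<close>

definition barycentric_coords :: "'a::real_vector set set \<Rightarrow> 'a \<Rightarrow> ('a \<Rightarrow> real) \<Rightarrow> bool" where
  "barycentric_coords \<S> x t \<longleftrightarrow>
     (\<exists>C\<in>\<S>. (\<forall>v\<in>C. 0 \<le> t v) \<and> (\<forall>v. v \<notin> C \<longrightarrow> t v = 0) \<and> sum t C = 1 \<and> (\<Sum>v\<in>C. t v *\<^sub>R v) = x)"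

text \<open>
  A simplicial complex is represented by the family of the vertex sets of its simplices. Uniqueness
  of barycentric coordinates across the whole family encodes both the affine independence of each
  member and the condition that two simplices meet in a common face.
\<close>

definition vertex_complex :: "'a::real_vector set set \<Rightarrow> bool" where
  "vertex_complex \<S> \<longleftrightarrow>
     finite \<S> \<and> (\<forall>C\<in>\<S>. finite C \<and> Pow C \<subseteq> \<S>) \<and>
     (\<forall>x t t'. barycentric_coords \<S> x t \<longrightarrow> barycentric_coords \<S> x t' \<longrightarrow> t = t')"

text \<open>Affine independence makes \<open>C\<close> the actual vertex set; otherwise
  \<open>C\<close> could be padded with further points of the simplex.\<close>

definition vertex_sets :: "'a::euclidean_space set set \<Rightarrow> 'a set set" where
  "vertex_sets K = {C. \<not> affine_dependent C \<and> convex hull C \<in> K}"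

lemma barycentric_coordsI:
  assumes "C \<in> \<S>" "\<And>v. v \<in> C \<Longrightarrow> 0 \<le> t v" "\<And>v. v \<notin> C \<Longrightarrow> t v = 0"
    "sum t C = 1" "(\<Sum>v\<in>C. t v *\<^sub>R v) = x"
  shows "barycentric_coords \<S> x t"
  unfolding barycentric_coords_def using assms by (intro bexI[of _ C]) auto

lemma barycentric_coords_exist:
  assumes "finite C" "C \<in> \<S>" "x \<in> convex hull C"
  obtains t where "barycentric_coords \<S> x t" "\<And>v. v \<in> C \<Longrightarrow> 0 \<le> t v" "\<And>v. v \<notin> C \<Longrightarrow> t v = 0"
    "sum t C = 1" "(\<Sum>v\<in>C. t v *\<^sub>R v) = x"
proof -
  obtain u where u: "\<forall>v\<in>C. 0 \<le> u v" "sum u C = 1" "(\<Sum>v\<in>C. u v *\<^sub>R v) = x"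
    using assms convex_hull_finite[OF assms(1)] by auto
  \<comment> \<open>The default 0 outside \<open>C\<close> makes coordinates taken in different
    simplices comparable as functions.\<close>
  define t where "t = (\<lambda>v. if v \<in> C then u v else 0)"
  have t: "\<And>v. v \<in> C \<Longrightarrow> 0 \<le> t v" "\<And>v. v \<notin> C \<Longrightarrow> t v = 0" "sum t C = 1" "(\<Sum>v\<in>C. t v *\<^sub>R v) = x"
    using u by (auto simp: t_def cong: sum.cong)
  then show ?thesis using that barycentric_coordsI[OF \<open>C \<in> \<S>\<close>, of t x] by blast
qed

lemma vertex_complexD:
  assumes "vertex_complex \<S>"
  shows "finite \<S>" "C \<in> \<S> \<Longrightarrow> finite C" "C \<in> \<S> \<Longrightarrow> D \<subseteq> C \<Longrightarrow> D \<in> \<S>"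
    "barycentric_coords \<S> x t \<Longrightarrow> barycentric_coords \<S> x t' \<Longrightarrow> t = t'"
  using assms unfolding vertex_complex_def by (simp, simp, blast, metis)

text \<open>An affine dependence could be used to perturb the coordinates of the barycentre.\<close>

lemma vertex_complex_affine_independent:
  assumes vc: "vertex_complex \<S>" and C: "C \<in> \<S>"
  shows "\<not> affine_dependent C"
proof
  have fin: "finite C" using vertex_complexD(2)[OF vc C] .
  assume "affine_dependent C"
  then obtain U v0 where U: "sum U C = 0" "v0 \<in> C" "U v0 \<noteq> 0" "(\<Sum>v\<in>C. U v *\<^sub>R v) = 0"
    unfolding affine_dependent_explicit_finite[OF fin] by blast
  define n where "n = real (card C)"
  have n: "n > 0" using fin U(2) unfolding n_def by (metis card_gt_0_iff empty_iff of_nat_0_less_iff)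
  define s where "s = (\<Sum>v\<in>C. \<bar>U v\<bar>)"
  have s0: "s \<ge> 0" unfolding s_def by (simp add: sum_nonneg)
  \<comment> \<open>Small enough that \<open>e * \<bar>U v\<bar>\<close> stays below the barycentric
    weight \<open>1/n\<close>; \<open>1 + s\<close> is a visibly positive bound for all
    \<open>\<bar>U v\<bar>\<close>.\<close>
  define e where "e = 1 / (n * (1 + s))"
  have e: "e > 0" using n s0 unfolding e_def by simp
  define t where "t = (\<lambda>v. if v \<in> C then 1/n else 0)"
  define t' where "t' = (\<lambda>v. if v \<in> C then 1/n + e * U v else 0)"
  define x where "x = (\<Sum>v\<in>C. (1/n) *\<^sub>R v)"
  have "barycentric_coords \<S> x t"
    using C n by (rule_tac barycentric_coordsI[OF C]) (auto simp: t_def x_def n_def cong: sum.cong)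
  moreover have "barycentric_coords \<S> x t'"
  proof (rule barycentric_coordsI[OF C])
    fix v assume v: "v \<in> C"
    have "\<bar>U v\<bar> \<le> s" unfolding s_def using member_le_sum[OF v, of "\<lambda>v. \<bar>U v\<bar>"] fin by simp
    then have "e * \<bar>U v\<bar> \<le> e * (1 + s)" using e by simp
    also have "\<dots> = 1/n" using s0 n by (simp add: e_def)
    finally have "\<bar>e * U v\<bar> \<le> 1/n" using e by (simp add: abs_mult)
    then show "0 \<le> t' v" using v by (simp add: t'_def)
  next
    show "sum t' C = 1"
      using n U(1) by (simp add: t'_def sum.distrib n_def flip: sum_distrib_left cong: sum.cong)
    have "(\<Sum>v\<in>C. t' v *\<^sub>R v) = x + e *\<^sub>R (\<Sum>v\<in>C. U v *\<^sub>R v)"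
      by (simp add: t'_def x_def scaleR_add_left sum.distrib scaleR_sum_right cong: sum.cong)
    then show "(\<Sum>v\<in>C. t' v *\<^sub>R v) = x" using U(4) by simp
  qed (auto simp: t'_def)
  ultimately have "t = t'" by (rule vertex_complexD(4)[OF vc])
  then have "t v0 = t' v0" by simp
  then show False using U e by (simp add: t_def t'_def)
qed

text \<open>A common point has a single coordinate function, which vanishes off \<open>C\<close> and
  off \<open>D\<close> and so is supported on the common vertices.\<close>

lemma vertex_complex_hull_Int:
  assumes vc: "vertex_complex \<S>" and "C \<in> \<S>" "D \<in> \<S>"
  shows "convex hull C \<inter> convex hull D = convex hull (C \<inter> D)"
proof
  have fin: "finite C" "finite D" using vertex_complexD(2)[OF vc] assms by blast+
  show "convex hull C \<inter> convex hull D \<subseteq> convex hull (C \<inter> D)"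
  proof
    fix x assume "x \<in> convex hull C \<inter> convex hull D"
    then have x: "x \<in> convex hull C" "x \<in> convex hull D" by auto
    obtain t where t: "barycentric_coords \<S> x t" "\<And>v. v \<in> C \<Longrightarrow> 0 \<le> t v" "\<And>v. v \<notin> C \<Longrightarrow> t v = 0"
      "sum t C = 1" "(\<Sum>v\<in>C. t v *\<^sub>R v) = x"
      using barycentric_coords_exist[OF fin(1) \<open>C \<in> \<S>\<close> x(1)] by metis
    obtain t' where t': "barycentric_coords \<S> x t'" "\<And>v. v \<notin> D \<Longrightarrow> t' v = 0"
      using barycentric_coords_exist[OF fin(2) \<open>D \<in> \<S>\<close> x(2)] by metis
    have "t = t'" using vertex_complexD(4)[OF vc t(1) t'(1)] .
    then have z: "t v = 0" if "v \<in> C - (C \<inter> D)" for v using that t'(2) by auto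
    have 1: "sum t (C \<inter> D) = 1"
      using t(4) z fin by (subst sum.mono_neutral_left[of C]) auto
    have 2: "(\<Sum>v\<in>C \<inter> D. t v *\<^sub>R v) = x"
      using t(5) z fin by (subst sum.mono_neutral_left[of C]) auto
    have "finite (C \<inter> D)" using fin by simp
    then show "x \<in> convex hull (C \<inter> D)"
      unfolding convex_hull_finite[OF \<open>finite (C \<inter> D)\<close>] using 1 2 t(2) by blast
  qed
qed (simp add: hull_mono)

lemma simplicial_complex_convex_hulls:
  fixes \<S> :: "'a::euclidean_space set set"
  assumes vc: "vertex_complex \<S>"
  shows "simplicial_complex ((hull) convex ` \<S>)"
  unfolding simplicial_complex_def
proof (intro conjI ballI allI impI)
  show "finite ((hull) convex ` \<S>)" using vertex_complexD(1)[OF vc] by simp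
next
  fix S assume "S \<in> (hull) convex ` \<S>"
  then obtain C where C: "C \<in> \<S>" "S = convex hull C" by auto
  \<comment> \<open>Integer subtraction, so that the empty simplex gets dimension -1.\<close>
  then have "(int (card C) - 1) simplex S"
    using vertex_complex_affine_independent[OF vc] by (auto intro: simplex_convex_hull)
  then show "\<exists>n. n simplex S" by blast
next
  fix F S assume *: "S \<in> (hull) convex ` \<S> \<and> F face_of S"
  then obtain C where C: "C \<in> \<S>" "S = convex hull C" by auto
  then obtain D where "D \<subseteq> C" "F = convex hull D"
    using * face_of_convex_hull_affine_independent[OF vertex_complex_affine_independent[OF vc C(1)]] by auto
  then show "F \<in> (hull) convex ` \<S>" using vertex_complexD(3)[OF vc C(1)] by blast
next
  fix S S' assume *: "S \<in> (hull) convex ` \<S> \<and> S' \<in> (hull) convex ` \<S>"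
  then obtain C D where C: "C \<in> \<S>" "S = convex hull C" "D \<in> \<S>" "S' = convex hull D" by auto
  show "S \<inter> S' face_of S"
    using face_of_convex_hull_affine_independent[OF vertex_complex_affine_independent[OF vc C(1)]]
      vertex_complex_hull_Int[OF vc C(1,3)] C by auto
qed

lemma extreme_points_affine_independent_hull:
  fixes C :: "'a::euclidean_space set"
  assumes "\<not> affine_dependent C"
  shows "{x. x extreme_point_of (convex hull C)} = C"
  using extreme_point_of_convex_hull_affine_independent[OF assms] by auto

text \<open>Both sets are recovered as the extreme points of the common hull.\<close>

lemma affine_independent_hull_inject:
  fixes C :: "'a::euclidean_space set"
  assumes "\<not> affine_dependent C" "\<not> affine_dependent D" "convex hull C = convex hull D"
  shows "C = D"
  by (subst extreme_points_affine_independent_hull[OF assms(1), symmetric],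
      subst extreme_points_affine_independent_hull[OF assms(2), symmetric]) (simp only: assms(3))

lemma affine_independent_coords_unique:
  assumes "finite C" "\<not> affine_dependent C" "sum t C = sum s C"
    "(\<Sum>v\<in>C. t v *\<^sub>R v) = (\<Sum>v\<in>C. s v *\<^sub>R v)" "v \<in> C"
  shows "t v = s v"
proof (rule ccontr)
  assume "t v \<noteq> s v"
  then have "\<exists>v\<in>C. t v - s v \<noteq> 0" using assms by auto
  moreover have "(\<Sum>v\<in>C. t v - s v) = 0" "(\<Sum>v\<in>C. (t v - s v) *\<^sub>R v) = 0"
    using assms by (simp_all add: sum_subtractf scaleR_diff_left)
  ultimately show False using affine_dependent_explicit_finite[OF assms(1)] assms(2) by blast
qed

lemma simplicial_complexD:
  assumes "simplicial_complex K"
  shows "finite K" "S \<in> K \<Longrightarrow> \<exists>n. n simplex S" "S \<in> K \<Longrightarrow> F face_of S \<Longrightarrow> F \<in> K"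
    "S \<in> K \<Longrightarrow> S' \<in> K \<Longrightarrow> (S \<inter> S') face_of S"
  using assms unfolding simplicial_complex_def by (simp, simp, metis, simp)

lemma convex_hulls_vertex_sets:
  assumes K: "simplicial_complex K"
  shows "(hull) convex ` vertex_sets K = K"
proof -
  have "S \<in> (hull) convex ` vertex_sets K" if S: "S \<in> K" for S
  proof -
    obtain n where "n simplex S" using simplicial_complexD(2)[OF K S] by blast
    then obtain C where "\<not> affine_dependent C" "S = convex hull C" unfolding simplex by auto
    then show ?thesis using S unfolding vertex_sets_def by auto
  qed
  then show ?thesis by (auto simp: vertex_sets_def)
qed

text \<open>Two simplices meet in a common face, whose vertex set \<open>c\<close> lies in both
  \<open>C\<close> and \<open>D\<close>. The coordinates of \<open>x\<close> on \<open>c\<close>,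
  extended by 0, are coordinates on \<open>C\<close> and on \<open>D\<close>, and affine
  independence of each forces \<open>t\<close> and \<open>t'\<close> to agree with them.\<close>

lemma vertex_complex_vertex_sets:
  fixes K :: "'a::euclidean_space set set"
  assumes K: "simplicial_complex K"
  shows "vertex_complex (vertex_sets K)"
  unfolding vertex_complex_def
proof (intro conjI ballI allI impI)
  have "C \<in> (\<lambda>S. {x. x extreme_point_of S}) ` K" if "C \<in> vertex_sets K" for C
    using that by (intro image_eqI[of _ _ "convex hull C"])
      (simp_all add: vertex_sets_def extreme_points_affine_independent_hull)
  then show "finite (vertex_sets K)"
    using simplicial_complexD(1)[OF K] by (meson finite_surj subsetI)
next
  fix C assume C: "C \<in> vertex_sets K"
  then have ind: "\<not> affine_dependent C" by (simp add: vertex_sets_def)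
  show "finite C" using aff_independent_finite[OF ind] .
  show "Pow C \<subseteq> vertex_sets K"
  proof
    fix D assume "D \<in> Pow C"
    then have "convex hull D face_of convex hull C" "\<not> affine_dependent D"
      using face_of_convex_hull_affine_independent[OF ind] affine_independent_subset[OF ind] by auto
    then show "D \<in> vertex_sets K"
      using C simplicial_complexD(3)[OF K, of "convex hull C" "convex hull D"]
      by (simp add: vertex_sets_def)
  qed
next
  fix x t t' assume "barycentric_coords (vertex_sets K) x t" and t': "barycentric_coords (vertex_sets K) x t'"
  then obtain C where C: "C \<in> vertex_sets K" "\<forall>v\<in>C. 0 \<le> t v" "\<forall>v. v \<notin> C \<longrightarrow> t v = 0" "sum t C = 1" "(\<Sum>v\<in>C. t v *\<^sub>R v) = x"
    unfolding barycentric_coords_def by blast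
  obtain D where D: "D \<in> vertex_sets K" "\<forall>v\<in>D. 0 \<le> t' v" "\<forall>v. v \<notin> D \<longrightarrow> t' v = 0" "sum t' D = 1" "(\<Sum>v\<in>D. t' v *\<^sub>R v) = x"
    using t' unfolding barycentric_coords_def by blast
  have ind: "\<not> affine_dependent C" "\<not> affine_dependent D" using C D by (auto simp: vertex_sets_def)
  have fin: "finite C" "finite D" using ind aff_independent_finite by auto
  define F where "F = convex hull C \<inter> convex hull D"
  have "F face_of convex hull C" "F face_of convex hull D"
    using C(1) D(1) simplicial_complexD(4)[OF K, of "convex hull C" "convex hull D"]
      simplicial_complexD(4)[OF K, of "convex hull D" "convex hull C"]
    unfolding F_def vertex_sets_def by (simp_all add: Int_commute)
  then obtain c c' where c: "c \<subseteq> C" "F = convex hull c" "c' \<subseteq> D" "F = convex hull c'"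
    using face_of_convex_hull_affine_independent[OF ind(1)]
      face_of_convex_hull_affine_independent[OF ind(2)] by auto
  have "\<not> affine_dependent c" "\<not> affine_dependent c'"
    using c affine_independent_subset ind by blast+
  then have "c = c'" using affine_independent_hull_inject[of c c'] c by simp
  have "x \<in> convex hull C" "x \<in> convex hull D"
    unfolding convex_hull_finite[OF fin(1)] convex_hull_finite[OF fin(2)] using C D by auto
  then have "x \<in> convex hull c" using c F_def by auto
  \<comment> \<open>\<open>UNIV\<close> serves as the family here: only the coordinates themselves
    are wanted.\<close>
  then obtain s where s: "\<And>v. v \<notin> c \<Longrightarrow> s v = 0" "sum s c = 1" "(\<Sum>v\<in>c. s v *\<^sub>R v) = x"
    using barycentric_coords_exist[OF finite_subset[OF c(1) fin(1)] UNIV_I] by blast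
  have ext: "t'' = s"
    if B: "finite B" "\<not> affine_dependent B" "c \<subseteq> B" "\<forall>v. v \<notin> B \<longrightarrow> t'' v = 0"
      "sum t'' B = 1" "(\<Sum>v\<in>B. t'' v *\<^sub>R v) = x" for B t''
  proof
    fix v
    have "sum s B = 1" "(\<Sum>v\<in>B. s v *\<^sub>R v) = x"
      using s B by (auto simp: sum.mono_neutral_right[OF B(1,3)])
    then show "t'' v = s v"
      using affine_independent_coords_unique[OF B(1,2), of t'' s v] B s(1) by (cases "v \<in> B") auto
  qed
  show "t = t'"
    using ext[OF fin(1) ind(1) c(1), of t] ext[OF fin(2) ind(2), of t'] c \<open>c = c'\<close> C D by auto
qed

subsection \<open>Weights on chains of sets\<close>

lemma chain_subsetD: "chain\<^sub>\<subseteq> X \<Longrightarrow> C \<in> X \<Longrightarrow> D \<in> X \<Longrightarrow> C \<subseteq> D \<or> D \<subseteq> C"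
  unfolding chain_subset_def by simp

lemma chain_subset_mono: "chain\<^sub>\<subseteq> X \<Longrightarrow> Y \<subseteq> X \<Longrightarrow> chain\<^sub>\<subseteq> Y"
  unfolding chain_subset_def by blast

lemma chain_greatest:
  assumes "finite X" "X \<noteq> {}" "chain\<^sub>\<subseteq> X"
  obtains C where "C \<in> X" "\<And>D. D \<in> X \<Longrightarrow> D \<subseteq> C"
proof -
  obtain C where C: "C \<in> X" "\<forall>D\<in>X. C \<subseteq> D \<longrightarrow> C = D" using finite_has_maximal[OF assms(1,2)] by auto
  have "D \<subseteq> C" if "D \<in> X" for D using chain_subsetD[OF assms(3) C(1) that] C(2) that by auto
  then show ?thesis using that C(1) by blast
qed

text \<open>A point of \<open>C\<close> lies in every superset of \<open>C\<close>. In a chain, the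
  members containing a point outside \<open>C\<close> are strict supersets of \<open>C\<close>, so
  such a point misses at least the positive weight \<open>a C\<close>.\<close>

lemma chain_superlevel_set:
  fixes a :: "'a set \<Rightarrow> real"
  assumes fin: "finite X" and ch: "chain\<^sub>\<subseteq> X" and a: "\<And>D. D \<in> X \<Longrightarrow> 0 \<le> a D"
    and C: "C \<in> X" "0 < a C"
  shows "C = {v. (\<Sum>D | D \<in> X \<and> C \<subseteq> D. a D) \<le> (\<Sum>D | D \<in> X \<and> v \<in> D. a D)}"
proof (intro equalityI subsetI CollectI)
  fix v assume v: "v \<in> C"
  show "(\<Sum>D | D \<in> X \<and> C \<subseteq> D. a D) \<le> (\<Sum>D | D \<in> X \<and> v \<in> D. a D)"
    using fin a v by (intro sum_mono2) auto
next
  fix v assume v: "v \<in> {v. (\<Sum>D | D \<in> X \<and> C \<subseteq> D. a D) \<le> (\<Sum>D | D \<in> X \<and> v \<in> D. a D)}"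
  show "v \<in> C"
  proof (rule ccontr)
    assume nv: "v \<notin> C"
    have "(\<Sum>D | D \<in> X \<and> v \<in> D. a D) \<le> (\<Sum>D\<in>{D \<in> X. C \<subseteq> D} - {C}. a D)"
    proof (intro sum_mono2)
      show "{D \<in> X. v \<in> D} \<subseteq> {D \<in> X. C \<subseteq> D} - {C}"
        using chain_subsetD[OF ch C(1)] nv by blast
    qed (use fin a in auto)
    also have "\<dots> = (\<Sum>D | D \<in> X \<and> C \<subseteq> D. a D) - a C"
      using fin C by (simp add: sum_diff1)
    finally show False using v C(2) by simp
  qed
qed

text \<open>The greatest member with nonzero coefficient has a point outside all other such members;
  evaluating there isolates its coefficient.\<close>

lemma chain_indicators_independent:
  fixes c :: "'a set \<Rightarrow> real"
  assumes fin: "finite Z" and ch: "chain\<^sub>\<subseteq> Z" and ne: "{} \<notin> Z"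
    and eq: "\<And>v. (\<Sum>D | D \<in> Z \<and> v \<in> D. c D) = 0" and C: "C \<in> Z"
  shows "c C = 0"
proof (rule ccontr)
  assume "c C \<noteq> 0"
  define N where "N = {D \<in> Z. c D \<noteq> 0}"
  have "C \<in> N" "finite N" "chain\<^sub>\<subseteq> N"
    using C \<open>c C \<noteq> 0\<close> fin chain_subset_mono[OF ch, of N] by (auto simp: N_def)
  then obtain B where B: "B \<in> N" "\<And>D. D \<in> N \<Longrightarrow> D \<subseteq> B" using chain_greatest[of N] by auto
  obtain v where v: "v \<in> B" "\<And>D. D \<in> N - {B} \<Longrightarrow> v \<notin> D"
  proof (cases "N - {B} = {}")
    case True
    then show ?thesis using that B(1) ne unfolding N_def by (metis (no_types, lifting) empty_iff ex_in_conv mem_Collect_eq)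
  next
    case False
    have "finite (N - {B})" "chain\<^sub>\<subseteq> (N - {B})" using \<open>finite N\<close> chain_subset_mono[OF \<open>chain\<^sub>\<subseteq> N\<close>] by auto
    then obtain B' where B': "B' \<in> N - {B}" "\<And>D. D \<in> N - {B} \<Longrightarrow> D \<subseteq> B'"
      using chain_greatest[OF _ False] by blast
    then have "B' \<subset> B" using B(2) by blast
    then show ?thesis using that B'(2) by blast
  qed
  have "(\<Sum>D | D \<in> Z \<and> v \<in> D. c D) = (\<Sum>D\<in>{B}. c D)"
  proof (rule sum.mono_neutral_right)
    show "\<forall>D\<in>{D \<in> Z. v \<in> D} - {B}. c D = 0" using v(2) unfolding N_def by blast
  qed (use fin B(1) v(1) N_def in auto)
  then show False using eq[of v] B(1) N_def by simp
qed

text \<open>The members of positive weight are superlevel sets of the common sum, so the two supports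
  together still form a chain.\<close>

lemma chain_weights_unique:
  fixes a b :: "'a set \<Rightarrow> real"
  assumes X: "finite X" "chain\<^sub>\<subseteq> X" "{} \<notin> X" "\<And>D. D \<in> X \<Longrightarrow> 0 \<le> a D" "\<And>D. D \<notin> X \<Longrightarrow> a D = 0"
    and Y: "finite Y" "chain\<^sub>\<subseteq> Y" "{} \<notin> Y" "\<And>D. D \<in> Y \<Longrightarrow> 0 \<le> b D" "\<And>D. D \<notin> Y \<Longrightarrow> b D = 0"
    and eq: "\<And>v. (\<Sum>D | D \<in> X \<and> v \<in> D. a D) = (\<Sum>D | D \<in> Y \<and> v \<in> D. b D)"
  shows "a = b"
proof
  fix C
  define l where "l = (\<lambda>v. \<Sum>D | D \<in> X \<and> v \<in> D. a D)"
  define Z where "Z = {D \<in> X. a D > 0} \<union> {D \<in> Y. b D > 0}"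
  have level: "\<exists>s. D = {v. s \<le> l v}" if "D \<in> Z" for D
    using that unfolding Z_def
  proof
    assume "D \<in> {D \<in> X. a D > 0}"
    then show ?thesis using chain_superlevel_set[OF X(1,2), of a D] X(4) unfolding l_def by blast
  next
    assume "D \<in> {D \<in> Y. b D > 0}"
    then show ?thesis using chain_superlevel_set[OF Y(1,2), of b D] Y(4) unfolding l_def eq by blast
  qed
  have "chain\<^sub>\<subseteq> Z" unfolding chain_subset_def
  proof (intro ballI)
    fix D E assume "D \<in> Z" "E \<in> Z"
    then obtain s s' where s: "D = {v. s \<le> l v}" "E = {v. s' \<le> l v}" using level by blast
    show "D \<subseteq> E \<or> E \<subseteq> D"
      unfolding s by (cases "s \<le> s'") auto
  qed
  have fZ: "finite Z" "{} \<notin> Z" using X Y unfolding Z_def by auto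
  have a0: "a D = 0" if "D \<notin> Z" for D
    using that X(4)[of D] X(5)[of D] unfolding Z_def by (cases "D \<in> X") auto
  have b0: "b D = 0" if "D \<notin> Z" for D
    using that Y(4)[of D] Y(5)[of D] unfolding Z_def by (cases "D \<in> Y") auto
  have resum: "(\<Sum>D | D \<in> Z \<and> v \<in> D. c D) = (\<Sum>D | D \<in> W \<and> v \<in> D. c D)"
    if "finite W" "\<And>D. D \<notin> W \<Longrightarrow> c D = 0" "\<And>D. D \<notin> Z \<Longrightarrow> c D = 0" for v W and c :: "'a set \<Rightarrow> real"
    using that fZ(1) by (intro sum.mono_neutral_cong) auto
  have "(\<Sum>D | D \<in> Z \<and> v \<in> D. a D - b D) = 0" for v
    using resum[where v = v, OF X(1,5) a0] resum[where v = v, OF Y(1,5) b0] eq[of v]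
    by (simp add: sum_subtractf)
  note indep = chain_indicators_independent[OF fZ(1) \<open>chain\<^sub>\<subseteq> Z\<close> fZ(2) this]
  show "a C = b C"
  proof (cases "C \<in> Z")
    case True then show ?thesis using indep[of C] by simp
  next
    case False
    then show ?thesis using a0 b0 False by simp
  qed
qed

text \<open>Greedy peeling: give \<open>C\<close> the minimum \<open>m\<close> of \<open>u\<close>,
  subtract \<open>m\<close> everywhere, drop one minimizer \<open>w\<close> and recurse. All later
  sets avoid \<open>w\<close>, so its value stays exactly \<open>m\<close>; ties only produce sets
  of weight 0.\<close>

lemma chain_weights_exist:
  fixes u :: "'a \<Rightarrow> real"
  assumes "finite C" "\<And>v. v \<in> C \<Longrightarrow> 0 \<le> u v"
  shows "\<exists>X a. X \<subseteq> Pow C - {{}} \<and> chain\<^sub>\<subseteq> X \<and> (\<forall>D\<in>X. 0 \<le> a D) \<and>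
           (\<forall>v\<in>C. u v = (\<Sum>D | D \<in> X \<and> v \<in> D. a D))"
  using assms
proof (induction "card C" arbitrary: C u rule: less_induct)
  case less
  show ?case
  proof (cases "C = {}")
    case True
    then show ?thesis by (intro exI[of _ "{}"]) (auto simp: chain_subset_def)
  next
    case False
    define m where "m = Min (u ` C)"
    have "m \<in> u ` C" unfolding m_def using less.prems(1) False by simp
    then obtain w where w: "w \<in> C" "u w = m" by auto
    have m: "m \<le> u v" if "v \<in> C" for v unfolding m_def using less.prems(1) that by simp
    have "card (C - {w}) < card C" using less.prems(1) w(1) by (meson card_Diff1_less)
    then obtain X a where X: "X \<subseteq> Pow (C - {w}) - {{}}" "chain\<^sub>\<subseteq> X" "\<forall>D\<in>X. 0 \<le> a D"
      "\<forall>v\<in>C - {w}. u v - m = (\<Sum>D | D \<in> X \<and> v \<in> D. a D)"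
      using less.hyps[of "C - {w}" "\<lambda>v. u v - m"] less.prems(1) m by auto
    define a' where "a' = a(C := m)"
    have C: "C \<notin> X" using X(1) w(1) by blast
    have fX: "finite X" using X(1) less.prems(1) by (meson finite_Diff finite_Pow_iff finite_subset)
    have a': "a' D = a D" if "D \<in> X" for D using that C unfolding a'_def by auto
    show ?thesis
    proof (intro exI[of _ "insert C X"] exI[of _ a'] conjI ballI)
      show "insert C X \<subseteq> Pow C - {{}}" using X(1) False by auto
      show "chain\<^sub>\<subseteq> (insert C X)" using X(1,2) unfolding chain_subset_def by blast
    next
      fix D assume "D \<in> insert C X"
      then show "0 \<le> a' D" using X(3) a' w less.prems(2)[OF w(1)] by (auto simp: a'_def)
    next
      fix v assume v: "v \<in> C"
      have "{D. D \<in> insert C X \<and> v \<in> D} = insert C {D \<in> X. v \<in> D}" using v by auto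
      then have "(\<Sum>D | D \<in> insert C X \<and> v \<in> D. a' D) = a' C + (\<Sum>D | D \<in> X \<and> v \<in> D. a' D)"
        using fX C by simp
      also have "(\<Sum>D | D \<in> X \<and> v \<in> D. a' D) = (\<Sum>D | D \<in> X \<and> v \<in> D. a D)"
        using a' by (intro sum.cong) auto
      also have "\<dots> = u v - m"
      proof (cases "v = w")
        case True
        then have none: "{D. D \<in> X \<and> v \<in> D} = {}" using X(1) by blast
        show ?thesis using w True unfolding none by simp
      qed (use X(4) v in auto)
      finally show "u v = (\<Sum>D | D \<in> insert C X \<and> v \<in> D. a' D)" by (simp add: a'_def)
    qed
  qed
qed

text \<open>Stated for general \<open>f\<close> to serve twice: the constant 1 gives the total
  coordinate mass, the identity gives the point itself.\<close>

lemma sum_scaleR_swap_members: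
  fixes w :: "'a set \<Rightarrow> real" and f :: "'a \<Rightarrow> 'b::real_vector"
  assumes "finite X" "finite V" "\<And>C. C \<in> X \<Longrightarrow> C \<subseteq> V"
  shows "(\<Sum>v\<in>V. (\<Sum>C | C \<in> X \<and> v \<in> C. w C) *\<^sub>R f v) = (\<Sum>C\<in>X. w C *\<^sub>R (\<Sum>v\<in>C. f v))"
proof -
  have "(\<Sum>v\<in>V. (\<Sum>C | C \<in> X \<and> v \<in> C. w C) *\<^sub>R f v) = (\<Sum>C\<in>X. \<Sum>v | v \<in> V \<and> v \<in> C. w C *\<^sub>R f v)"
    unfolding scaleR_sum_left by (rule sum.swap_restrict[OF assms(2,1)])
  also have "\<dots> = (\<Sum>C\<in>X. \<Sum>v\<in>C. w C *\<^sub>R f v)"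
    using assms(3) by (intro sum.cong) auto
  finally show ?thesis by (simp add: scaleR_sum_right)
qed

subsection \<open>Barycentric subdivision\<close>

definition barycenter :: "'a::real_vector set \<Rightarrow> 'a" where
  "barycenter C = (1 / real (card C)) *\<^sub>R \<Sum>C"

text \<open>The simplices are the flags of the old complex. The empty set is barred from chains
  because its barycenter would be the default value 0; the empty chain stays and supplies the empty
  simplex.\<close>

definition barycentric_subdivision :: "'a::real_vector set set \<Rightarrow> 'a set set" where
  "barycentric_subdivision \<S> = {barycenter ` X |X. X \<subseteq> \<S> - {{}} \<and> chain\<^sub>\<subseteq> X}"

lemma barycenter_in_hull:
  assumes "finite C" "C \<noteq> {}"
  shows "barycenter C \<in> convex hull C"
proof -
  have "(\<Sum>v\<in>C. (1 / real (card C)) *\<^sub>R v) \<in> convex hull C"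
    using assms by (intro convex_sum) (auto simp: hull_inc)
  then show ?thesis by (simp add: barycenter_def scaleR_sum_right)
qed

text \<open>Translation from new to old coordinates: each barycenter spreads its weight evenly over
  the vertices of its simplex, and the greatest member of the chain carries them all.\<close>

lemma chain_barycentric_coords:
  assumes vc: "vertex_complex \<S>" and X: "X \<subseteq> \<S> - {{}}" "chain\<^sub>\<subseteq> X"
    and a: "\<And>C. C \<in> X \<Longrightarrow> 0 \<le> a C" "sum a X = 1"
  shows "barycentric_coords \<S> (\<Sum>C\<in>X. a C *\<^sub>R barycenter C)
           (\<lambda>v. \<Sum>C | C \<in> X \<and> v \<in> C. a C / real (card C))"
proof -
  have fin: "finite X" using X(1) vertex_complexD(1)[OF vc] by (meson finite_Diff finite_subset)
  have "X \<noteq> {}" using a(2) by auto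
  then obtain B where B: "B \<in> X" "\<And>D. D \<in> X \<Longrightarrow> D \<subseteq> B" using chain_greatest[OF fin _ X(2)] by blast
  have BS: "B \<in> \<S>" using B(1) X(1) by blast
  have fB: "finite B" using vertex_complexD(2)[OF vc BS] .
  have card: "card C > 0" if "C \<in> X" for C
    using that B(2)[OF that] fB X(1) by (metis Diff_iff card_gt_0_iff finite_subset insertI1 subset_iff)
  show ?thesis
  proof (rule barycentric_coordsI[OF BS])
    show "0 \<le> (\<Sum>C | C \<in> X \<and> v \<in> C. a C / real (card C))" for v
      using a(1) by (intro sum_nonneg) auto
    show "(\<Sum>C | C \<in> X \<and> v \<in> C. a C / real (card C)) = 0" if "v \<notin> B" for v
      using B(2) that by (intro sum.neutral) blast
    have "(\<Sum>v\<in>B. \<Sum>C | C \<in> X \<and> v \<in> C. a C / real (card C))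
        = (\<Sum>C\<in>X. (a C / real (card C)) *\<^sub>R (\<Sum>v\<in>C. (1::real)))"
      using sum_scaleR_swap_members[OF fin fB B(2), of "\<lambda>C. a C / real (card C)" "\<lambda>_. 1::real"] by simp
    also have "\<dots> = sum a X" using card by (intro sum.cong) (auto simp: less_imp_neq)
    finally show "(\<Sum>v\<in>B. \<Sum>C | C \<in> X \<and> v \<in> C. a C / real (card C)) = 1" using a(2) by simp
    show "(\<Sum>v\<in>B. (\<Sum>C | C \<in> X \<and> v \<in> C. a C / real (card C)) *\<^sub>R v) = (\<Sum>C\<in>X. a C *\<^sub>R barycenter C)"
      using sum_scaleR_swap_members[OF fin fB B(2), of "\<lambda>C. a C / real (card C)" "\<lambda>v. v"]
      by (simp add: barycenter_def)
  qed
qed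

lemma barycentric_subdivision_coordsE:
  assumes vc: "vertex_complex \<S>" and t: "barycentric_coords (barycentric_subdivision \<S>) x t"
  obtains X a where "X \<subseteq> \<S> - {{}}" "chain\<^sub>\<subseteq> X" "\<forall>C\<in>X. 0 \<le> a C" "\<forall>C. C \<notin> X \<longrightarrow> a C = 0"
    "sum a X = 1" "(\<Sum>C\<in>X. a C *\<^sub>R barycenter C) = x"
    "\<forall>C\<in>X. t (barycenter C) = a C" "\<forall>p. p \<notin> barycenter ` X \<longrightarrow> t p = 0"
proof -
  obtain B where B: "B \<in> barycentric_subdivision \<S>" "\<forall>v\<in>B. 0 \<le> t v" "\<forall>v. v \<notin> B \<longrightarrow> t v = 0"
    "sum t B = 1" "(\<Sum>v\<in>B. t v *\<^sub>R v) = x"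
    using t unfolding barycentric_coords_def by blast
  obtain X0 where X0: "B = barycenter ` X0" "X0 \<subseteq> \<S> - {{}}" "chain\<^sub>\<subseteq> X0"
    using B(1) unfolding barycentric_subdivision_def by blast
  \<comment> \<open>Distinct members of the chain are not yet known to have distinct barycenters;
    one representative per barycenter makes the sums reindexable.\<close>
  obtain X where X: "X \<subseteq> X0" "inj_on barycenter X" "B = barycenter ` X"
    using subset_image_inj[of B barycenter X0] X0(1) by blast
  define a where "a = (\<lambda>C. if C \<in> X then t (barycenter C) else 0)"
  show ?thesis
  proof
    show "X \<subseteq> \<S> - {{}}" "chain\<^sub>\<subseteq> X" using X(1) X0(2) chain_subset_mono[OF X0(3)] by auto
    show "sum a X = 1"
      using B(4) unfolding X(3) sum.reindex[OF X(2)] by (simp add: a_def cong: sum.cong)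
    show "(\<Sum>C\<in>X. a C *\<^sub>R barycenter C) = x"
      using B(5) unfolding X(3) sum.reindex[OF X(2)] by (simp add: a_def cong: sum.cong)
  qed (use B X in \<open>auto simp: a_def\<close>)
qed

text \<open>Two representations of \<open>x\<close> over chains yield the same old coordinates,
  since those are unique. These coordinates are sums of the weights \<open>a C / card C\<close> over
  members containing a vertex, so uniqueness of chain weights identifies the two
  representations.\<close>

lemma vertex_complex_barycentric_subdivision:
  assumes vc: "vertex_complex \<S>"
  shows "vertex_complex (barycentric_subdivision \<S>)"
proof -
  have fS: "finite \<S>" using vertex_complexD(1)[OF vc] .
  have fX: "finite X" if "X \<subseteq> \<S> - {{}}" for X using that fS by (meson finite_Diff finite_subset)
  have "barycentric_subdivision \<S> \<subseteq> (`) barycenter ` Pow \<S>"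
    unfolding barycentric_subdivision_def by blast
  then have 1: "finite (barycentric_subdivision \<S>)" using fS by (meson finite_Pow_iff finite_imageI finite_subset)
  have 2: "finite B \<and> Pow B \<subseteq> barycentric_subdivision \<S>" if B: "B \<in> barycentric_subdivision \<S>" for B
  proof -
    obtain X where X: "B = barycenter ` X" "X \<subseteq> \<S> - {{}}" "chain\<^sub>\<subseteq> X"
      using B unfolding barycentric_subdivision_def by blast
    have "D \<in> barycentric_subdivision \<S>" if D: "D \<subseteq> B" for D
    proof -
      obtain Y where Y: "Y \<subseteq> X" "D = barycenter ` Y" using D unfolding X(1) subset_image_iff by blast
      then have "Y \<subseteq> \<S> - {{}}" "chain\<^sub>\<subseteq> Y" using X chain_subset_mono[OF X(3)] by auto
      then show ?thesis unfolding barycentric_subdivision_def using Y(2) by blast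
    qed
    then show ?thesis using fX[OF X(2)] X(1) by blast
  qed
  \<comment> \<open>One-sided on purpose: \<open>t p \<noteq> 0\<close> makes \<open>p\<close> the
    barycenter of a chain member. Exchanging \<open>t\<close> and \<open>t'\<close> covers the
    rest.\<close>
  have key: "t' p = t p"
    if t: "barycentric_coords (barycentric_subdivision \<S>) x t"
      "barycentric_coords (barycentric_subdivision \<S>) x t'" and nz: "t p \<noteq> 0" for x t t' p
  proof -
    obtain X a where X: "X \<subseteq> \<S> - {{}}" "chain\<^sub>\<subseteq> X" "\<forall>C\<in>X. 0 \<le> a C" "\<forall>C. C \<notin> X \<longrightarrow> a C = 0"
      "sum a X = 1" "(\<Sum>C\<in>X. a C *\<^sub>R barycenter C) = x"
      "\<forall>C\<in>X. t (barycenter C) = a C" "\<forall>p. p \<notin> barycenter ` X \<longrightarrow> t p = 0"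
      by (rule barycentric_subdivision_coordsE[OF vc t(1)])
    obtain Y b where Y: "Y \<subseteq> \<S> - {{}}" "chain\<^sub>\<subseteq> Y" "\<forall>C\<in>Y. 0 \<le> b C" "\<forall>C. C \<notin> Y \<longrightarrow> b C = 0"
      "sum b Y = 1" "(\<Sum>C\<in>Y. b C *\<^sub>R barycenter C) = x"
      "\<forall>C\<in>Y. t' (barycenter C) = b C" "\<forall>p. p \<notin> barycenter ` Y \<longrightarrow> t' p = 0"
      by (rule barycentric_subdivision_coordsE[OF vc t(2)])
    have "(\<lambda>v. \<Sum>C | C \<in> X \<and> v \<in> C. a C / real (card C)) = (\<lambda>v. \<Sum>C | C \<in> Y \<and> v \<in> C. b C / real (card C))"
      using chain_barycentric_coords[OF vc X(1,2) bspec[OF X(3)] X(5)]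
        chain_barycentric_coords[OF vc Y(1,2) bspec[OF Y(3)] Y(5)]
      unfolding X(6) Y(6) by (rule vertex_complexD(4)[OF vc])
    then have eq: "(\<Sum>C | C \<in> X \<and> v \<in> C. a C / real (card C)) = (\<Sum>C | C \<in> Y \<and> v \<in> C. b C / real (card C))" for v
      by (rule fun_cong)
    have "(\<lambda>C. a C / real (card C)) = (\<lambda>C. b C / real (card C))"
      by (rule chain_weights_unique[where X = X and Y = Y]) (use X Y fX eq in auto)
    then have ab: "a C / real (card C) = b C / real (card C)" for C by (rule fun_cong)
    obtain C where C: "C \<in> X" "p = barycenter C" using X(8) nz by blast
    then have "C \<noteq> {}" "finite C" using X(1) vertex_complexD(2)[OF vc] by auto
    then have "a C = b C" using ab[of C] by simp
    \<comment> \<open>Since \<open>b\<close> vanishes off \<open>Y\<close>, a nonzero common weight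
      puts \<open>C\<close> into \<open>Y\<close>, where \<open>t'\<close> is given by
      \<open>b\<close>.\<close>
    moreover have "a C \<noteq> 0" using X(7) C nz by simp
    ultimately show ?thesis using X(7) Y(4,7) C by metis
  qed
  have "t = t'" if "barycentric_coords (barycentric_subdivision \<S>) x t"
      "barycentric_coords (barycentric_subdivision \<S>) x t'" for x t t'
  proof
    fix p show "t p = t' p" using key[OF that, of p] key[OF that(2,1), of p] by fastforce
  qed
  then show ?thesis unfolding vertex_complex_def using 1 2 by auto
qed

text \<open>The greatest member of the chain contains all the barycenters in its hull. The
  subdivision of an empty family still has the empty simplex, hence the condition on
  \<open>B\<close>.\<close>

lemma barycentric_subdivision_hull_subset:
  assumes vc: "vertex_complex \<S>" and B: "B \<in> barycentric_subdivision \<S>" and ne: "B \<noteq> {}"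
  obtains C where "C \<in> \<S>" "convex hull B \<subseteq> convex hull C"
proof -
  obtain X where X: "B = barycenter ` X" "X \<subseteq> \<S> - {{}}" "chain\<^sub>\<subseteq> X"
    using B unfolding barycentric_subdivision_def by blast
  have fin: "finite X" using X(2) vertex_complexD(1)[OF vc] by (meson finite_Diff finite_subset)
  have "X \<noteq> {}" using X(1) ne by simp
  then obtain C where C: "C \<in> X" "\<And>D. D \<in> X \<Longrightarrow> D \<subseteq> C" using chain_greatest[OF fin _ X(3)] by blast
  have "C \<in> \<S>" using C(1) X(2) by blast
  have "B \<subseteq> convex hull C"
  proof
    fix p assume "p \<in> B"
    then obtain D where D: "D \<in> X" "p = barycenter D" using X(1) by blast
    then have "D \<noteq> {}" "finite D" using X(2) vertex_complexD(2)[OF vc] by auto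
    then have "p \<in> convex hull D" using barycenter_in_hull D(2) by blast
    then show "p \<in> convex hull C" using hull_mono[OF C(2)[OF D(1)]] by blast
  qed
  then have "convex hull B \<subseteq> convex hull C" by (simp add: hull_minimal)
  then show ?thesis by (rule that[OF \<open>C \<in> \<S>\<close>])
qed

text \<open>For the inclusion of the old polyhedron, peel the coordinates of \<open>x\<close> into
  weights \<open>a D\<close> on a chain. Each \<open>D\<close> then contributes its barycenter with
  weight \<open>a D * card D\<close>, and these weights sum to the total coordinate mass 1.\<close>

lemma Union_hull_barycentric_subdivision:
  assumes vc: "vertex_complex \<S>"
  shows "\<Union>((hull) convex ` barycentric_subdivision \<S>) = \<Union>((hull) convex ` \<S>)"
proof (intro equalityI subsetI)
  fix x assume "x \<in> \<Union>((hull) convex ` barycentric_subdivision \<S>)"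
  then obtain B where "B \<in> barycentric_subdivision \<S>" "x \<in> convex hull B" by blast
  moreover from this have "B \<noteq> {}" by auto
  ultimately show "x \<in> \<Union>((hull) convex ` \<S>)"
    using barycentric_subdivision_hull_subset[OF vc] by (metis UN_iff subsetD)
next
  fix x assume "x \<in> \<Union>((hull) convex ` \<S>)"
  then obtain C where C: "C \<in> \<S>" "x \<in> convex hull C" by blast
  have fC: "finite C" using vertex_complexD(2)[OF vc C(1)] .
  have "x \<in> {y. \<exists>u. (\<forall>v\<in>C. 0 \<le> u v) \<and> sum u C = 1 \<and> (\<Sum>v\<in>C. u v *\<^sub>R v) = y}"
    using C(2) by (simp only: convex_hull_finite[OF fC])
  then obtain u where u: "\<forall>v\<in>C. 0 \<le> u v" "sum u C = 1" "(\<Sum>v\<in>C. u v *\<^sub>R v) = x"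
    by auto
  obtain X a where X: "X \<subseteq> Pow C - {{}}" "chain\<^sub>\<subseteq> X" "\<forall>D\<in>X. 0 \<le> a D"
    "\<forall>v\<in>C. u v = (\<Sum>D | D \<in> X \<and> v \<in> D. a D)"
    using chain_weights_exist[OF fC, of u] u(1) by auto
  have fX: "finite X" using X(1) fC by (meson finite_Diff finite_Pow_iff finite_subset)
  have XC: "\<And>D. D \<in> X \<Longrightarrow> D \<subseteq> C" using X(1) by blast
  have nz: "card D \<noteq> 0" if "D \<in> X" for D
  proof -
    have "D \<noteq> {}" "finite D" using that X(1) fC by (auto intro: finite_subset)
    then show ?thesis by simp
  qed
  have "sum u C = (\<Sum>v\<in>C. (\<Sum>D | D \<in> X \<and> v \<in> D. a D) *\<^sub>R (1::real))"
    by (rule sum.cong) (use X(4) in \<open>simp_all only: real_scaleR_def mult_1_right\<close>)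
  also have "\<dots> = (\<Sum>D\<in>X. a D * real (card D))"
    using sum_scaleR_swap_members[OF fX fC XC, of a "\<lambda>_. 1::real"] by simp
  finally have 1: "(\<Sum>D\<in>X. a D * real (card D)) = 1" using u(2) by simp
  have "x = (\<Sum>v\<in>C. (\<Sum>D | D \<in> X \<and> v \<in> D. a D) *\<^sub>R v)"
    unfolding u(3)[symmetric] by (rule sum.cong) (use X(4) in simp_all)
  also have "\<dots> = (\<Sum>D\<in>X. a D *\<^sub>R \<Sum>D)"
    using sum_scaleR_swap_members[OF fX fC XC, of a "\<lambda>v. v"] by simp
  also have "\<dots> = (\<Sum>D\<in>X. (a D * real (card D)) *\<^sub>R barycenter D)"
    using nz by (intro sum.cong) (auto simp: barycenter_def)
  also have "\<dots> \<in> convex hull (barycenter ` X)"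
    using fX 1 X(3) by (intro convex_sum) (auto simp: hull_inc)
  finally have "x \<in> convex hull (barycenter ` X)" .
  moreover have "barycenter ` X \<in> barycentric_subdivision \<S>"
  proof -
    have "X \<subseteq> \<S> - {{}}" using X(1) vertex_complexD(3)[OF vc C(1)] by auto
    then show ?thesis using X(2) unfolding barycentric_subdivision_def by blast
  qed
  ultimately show "x \<in> \<Union>((hull) convex ` barycentric_subdivision \<S>)" by blast
qed

text \<open>Of the \<open>card D\<close> differences \<open>c - d\<close> averaged in \<open>c - barycenter D\<close>, the one with \<open>d = c\<close> vanishes.\<close>

lemma dist_barycenters_le:
  fixes D :: "'a::real_normed_vector set"
  assumes D: "finite D" "C \<subseteq> D" "C \<noteq> {}" and mesh: "\<And>u v. u \<in> D \<Longrightarrow> v \<in> D \<Longrightarrow> dist u v \<le> \<mu>"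
  shows "dist (barycenter C) (barycenter D) \<le> (1 - 1 / real (card D)) * \<mu>"
proof -
  define n where "n = real (card D)"
  have n: "n > 0" using D unfolding n_def by (metis card_gt_0_iff of_nat_0_less_iff subset_empty)
  have "C \<subseteq> cball (barycenter D) ((1 - 1/n) * \<mu>)"
  proof
    fix c assume c: "c \<in> C"
    then have cD: "c \<in> D" using D(2) by blast
    have "c - barycenter D = (1/n) *\<^sub>R (n *\<^sub>R c - \<Sum>D)"
      using n by (simp add: barycenter_def n_def scaleR_diff_right)
    also have "n *\<^sub>R c - \<Sum>D = (\<Sum>d\<in>D. c - d)" by (simp add: sum_subtractf n_def scaleR_left.sum sum_constant_scaleR)
    also have "\<dots> = (\<Sum>d\<in>D - {c}. c - d)" using D(1) cD by (simp add: sum.remove)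
    finally have "norm (c - barycenter D) = (1/n) * norm (\<Sum>d\<in>D - {c}. c - d)" using n by simp
    also have "\<dots> \<le> (1/n) * (\<Sum>d\<in>D - {c}. \<mu>)"
      using n mesh cD by (intro mult_left_mono sum_norm_le) (auto simp flip: dist_norm)
    also have "(\<Sum>d\<in>D - {c}. \<mu>) = (n - 1) * \<mu>" using D(1) cD n by (simp add: n_def of_nat_diff)
    also have "(1/n) * ((n - 1) * \<mu>) = (1 - 1/n) * \<mu>" using n by (simp add: field_simps)
    finally show "c \<in> cball (barycenter D) ((1 - 1/n) * \<mu>)" by (simp add: dist_norm norm_minus_commute)
  qed
  then have "convex hull C \<subseteq> cball (barycenter D) ((1 - 1/n) * \<mu>)" by (simp add: hull_minimal)
  then show ?thesis
    using barycenter_in_hull[of C] D finite_subset[OF D(2,1)] by (auto simp: n_def dist_commute)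
qed

text \<open>An affinely independent set has at most \<open>DIM('a) + 1\<close> points, so one
  contraction factor below 1 serves every simplex and every iteration.\<close>

lemma barycentric_subdivision_mesh:
  fixes \<S> :: "'a::euclidean_space set set"
  assumes vc: "vertex_complex \<S>"
    and mesh: "\<And>C u v. C \<in> \<S> \<Longrightarrow> u \<in> C \<Longrightarrow> v \<in> C \<Longrightarrow> dist u v \<le> \<mu>"
    and B: "B \<in> barycentric_subdivision \<S>" "p \<in> B" "q \<in> B"
  shows "dist p q \<le> (1 - 1 / real (DIM('a) + 1)) * \<mu>"
proof -
  obtain X where X: "B = barycenter ` X" "X \<subseteq> \<S> - {{}}" "chain\<^sub>\<subseteq> X"
    using B unfolding barycentric_subdivision_def by blast
  have main: "dist (barycenter C) (barycenter D) \<le> (1 - 1 / real (DIM('a) + 1)) * \<mu>"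
    if "C \<in> X" "D \<in> X" "C \<subseteq> D" for C D
  proof -
    have DS: "D \<in> \<S>" "D \<noteq> {}" "C \<noteq> {}" using that X(2) by auto
    have fD: "finite D" using vertex_complexD(2)[OF vc DS(1)] .
    obtain v where "v \<in> D" using DS(2) by blast
    then have \<mu>: "\<mu> \<ge> 0" using mesh[OF DS(1), of v v] by simp
    have "\<not> affine_dependent D" using vertex_complex_affine_independent[OF vc DS(1)] .
    then have "int (card D) \<le> int (DIM('a) + 1)"
      using aff_dim_affine_independent[of D] aff_dim_le_DIM[of D] by simp
    moreover have "card D > 0" using fD DS(2) by (simp add: card_gt_0_iff)
    ultimately have "1 / real (DIM('a) + 1) \<le> 1 / real (card D)" by (intro divide_left_mono) auto
    then have "(1 - 1 / real (card D)) * \<mu> \<le> (1 - 1 / real (DIM('a) + 1)) * \<mu>"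
      using \<mu> by (intro mult_right_mono) auto
    then show ?thesis
      using dist_barycenters_le[OF fD that(3) DS(3) mesh[OF DS(1)]] by linarith
  qed
  obtain C D where "C \<in> X" "p = barycenter C" "D \<in> X" "q = barycenter D" using B X(1) by blast
  then show ?thesis
    using chain_subsetD[OF X(3), of C D] main[of C D] main[of D C] by (auto simp: dist_commute)
qed

subsection \<open>Simplicial involutions\<close>

lemma affine_map_on_subset: "affine_map_on S f \<Longrightarrow> T \<subseteq> S \<Longrightarrow> affine_map_on T f"
  unfolding affine_map_on_def by blast

lemma affine_map_on_continuous:
  fixes f :: "'a::euclidean_space \<Rightarrow> 'b::euclidean_space"
  assumes "affine_map_on S f"
  shows "continuous_on S f"
proof -
  obtain g c where g: "linear g" "\<forall>x\<in>S. f x = g x + c" using assms unfolding affine_map_on_def by blast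
  have "continuous_on S (\<lambda>x. g x + c)"
    using g(1) by (intro continuous_intros linear_continuous_on) (simp add: linear_linear)
  then show ?thesis using g(2) by (simp cong: continuous_on_cong)
qed

lemma affine_map_on_convex_combination:
  assumes f: "affine_map_on (convex hull C) f" and C: "finite C" "\<forall>v\<in>C. 0 \<le> t v" "sum t C = 1"
  shows "f (\<Sum>v\<in>C. t v *\<^sub>R v) = (\<Sum>v\<in>C. t v *\<^sub>R f v)"
proof -
  obtain g c where g: "linear g" "\<forall>x\<in>convex hull C. f x = g x + c"
    using f unfolding affine_map_on_def by blast
  have "(\<Sum>v\<in>C. t v *\<^sub>R v) \<in> convex hull C"
    using C by (intro convex_sum) (auto simp: hull_inc)
  then have "f (\<Sum>v\<in>C. t v *\<^sub>R v) = g (\<Sum>v\<in>C. t v *\<^sub>R v) + c" using g(2) by blast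
  also have "\<dots> = (\<Sum>v\<in>C. t v *\<^sub>R g v) + (\<Sum>v\<in>C. t v) *\<^sub>R c"
    using g(1) C(3) by (simp add: linear_sum linear_scale)
  also have "\<dots> = (\<Sum>v\<in>C. t v *\<^sub>R (g v + c))"
    by (simp add: scaleR_add_right sum.distrib scaleR_sum_left)
  also have "\<dots> = (\<Sum>v\<in>C. t v *\<^sub>R f v)"
    by (rule sum.cong) (simp_all add: g(2) hull_inc)
  finally show ?thesis .
qed

lemma affine_map_on_hull_image:
  assumes "affine_map_on (convex hull C) f"
  shows "f ` (convex hull C) = convex hull (f ` C)"
proof -
  obtain g c where g: "linear g" "\<forall>x\<in>convex hull C. f x = g x + c"
    using assms unfolding affine_map_on_def by blast
  have "f ` S = (+) c ` g ` S" if "S \<subseteq> convex hull C" for S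
    unfolding image_image by (rule image_cong) (use g(2) that in \<open>auto simp: add.commute\<close>)
  from this[of "convex hull C"] this[of C] show ?thesis
    using g(1) hull_subset[of C convex] by (simp add: convex_hull_translation convex_hull_linear_image)
qed

text \<open>Injectivity on the vertices preserves their number and hence the equal weights.\<close>

lemma barycenter_image:
  assumes f: "affine_map_on (convex hull C) f" and C: "finite C" "C \<noteq> {}" "inj_on f C"
  shows "f (barycenter C) = barycenter (f ` C)"
proof -
  have "f (barycenter C) = (\<Sum>v\<in>C. (1 / real (card C)) *\<^sub>R f v)"
    using affine_map_on_convex_combination[OF f C(1), of "\<lambda>_. 1 / real (card C)"] C
    by (simp add: barycenter_def scaleR_sum_right)
  then show ?thesis
    using C by (simp add: barycenter_def scaleR_sum_right card_image sum.reindex)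
qed

text \<open>Injectivity is asked on the whole polyhedron, which subdivision leaves unchanged, so
  that this part of the invariant passes through iteration for free.\<close>

definition vertex_complex_symmetry :: "'a::real_vector set set \<Rightarrow> ('a \<Rightarrow> 'a) \<Rightarrow> bool" where
  "vertex_complex_symmetry \<S> \<tau> \<longleftrightarrow>
     inj_on \<tau> (\<Union>((hull) convex ` \<S>)) \<and> (\<forall>C\<in>\<S>. \<tau> ` C \<in> \<S> \<and> affine_map_on (convex hull C) \<tau>)"

text \<open>Affine injective maps carry barycenters to barycenters, and taking images preserves
  inclusions, so flags go to flags.\<close>

lemma vertex_complex_symmetry_subdivision:
  assumes vc: "vertex_complex \<S>" and sym: "vertex_complex_symmetry \<S> \<tau>"
  shows "vertex_complex_symmetry (barycentric_subdivision \<S>) \<tau>"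
proof -
  have inj: "inj_on \<tau> (\<Union>((hull) convex ` \<S>))"
    and simp: "\<And>C. C \<in> \<S> \<Longrightarrow> \<tau> ` C \<in> \<S>" "\<And>C. C \<in> \<S> \<Longrightarrow> affine_map_on (convex hull C) \<tau>"
    using sym unfolding vertex_complex_symmetry_def by blast+
  have "\<tau> ` B \<in> barycentric_subdivision \<S> \<and> affine_map_on (convex hull B) \<tau>"
    if B: "B \<in> barycentric_subdivision \<S>" for B
  proof
    obtain X where X: "B = barycenter ` X" "X \<subseteq> \<S> - {{}}" "chain\<^sub>\<subseteq> X"
      using B unfolding barycentric_subdivision_def by blast
    have "\<tau> (barycenter C) = barycenter (\<tau> ` C)" if "C \<in> X" for C
    proof (rule barycenter_image)
      have C: "C \<in> \<S>" "C \<noteq> {}" using that X(2) by auto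
      show "affine_map_on (convex hull C) \<tau>" "finite C" "C \<noteq> {}"
        using C simp(2) vertex_complexD(2)[OF vc] by auto
      have "C \<subseteq> \<Union>((hull) convex ` \<S>)" using C(1) hull_subset[of C convex] by blast
      then show "inj_on \<tau> C" using inj inj_on_subset by blast
    qed
    then have "\<tau> ` B = barycenter ` ((`) \<tau> ` X)" unfolding X(1) image_image by (rule image_cong[OF refl])
    moreover have "(`) \<tau> ` X \<subseteq> \<S> - {{}}" using X(2) simp(1) by auto
    moreover have "chain\<^sub>\<subseteq> ((`) \<tau> ` X)"
      unfolding chain_subset_def
    proof (intro ballI)
      fix A B assume "A \<in> (`) \<tau> ` X" "B \<in> (`) \<tau> ` X"
      then obtain C D where "C \<in> X" "D \<in> X" "A = \<tau> ` C" "B = \<tau> ` D" by auto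
      then show "A \<subseteq> B \<or> B \<subseteq> A" using chain_subsetD[OF X(3), of C D] by (auto simp: image_mono)
    qed
    ultimately show "\<tau> ` B \<in> barycentric_subdivision \<S>" unfolding barycentric_subdivision_def by blast
    show "affine_map_on (convex hull B) \<tau>"
    proof (cases "B = {}")
      case True
      have "affine_map_on {} \<tau>" unfolding affine_map_on_def using linear_zero by blast
      then show ?thesis using True by simp
    next
      case False
      obtain C where "C \<in> \<S>" "convex hull B \<subseteq> convex hull C"
        by (rule barycentric_subdivision_hull_subset[OF vc B False])
      then show ?thesis using simp(2) affine_map_on_subset by blast
    qed
  qed
  then show ?thesis
    using inj unfolding vertex_complex_symmetry_def Union_hull_barycentric_subdivision[OF vc] by blast
qed

lemma fine_symmetric_vertex_complex:
  fixes \<S> :: "'a::euclidean_space set set"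
  assumes vc: "vertex_complex \<S>" and sym: "vertex_complex_symmetry \<S> \<tau>" and e: "0 < e"
  obtains \<T> where "vertex_complex \<T>" "vertex_complex_symmetry \<T> \<tau>"
    "\<Union>((hull) convex ` \<T>) = \<Union>((hull) convex ` \<S>)"
    "\<forall>C\<in>\<T>. \<forall>u\<in>C. \<forall>v\<in>C. dist u v < e"
proof -
  define r where "r = 1 - 1 / real (DIM('a) + 1)"
  have r: "0 \<le> r" "r < 1" unfolding r_def by auto
  have "finite (\<Union>\<S>)" using vertex_complexD(1,2)[OF vc] by auto
  then have bd: "bounded (\<Union>\<S>)" by (rule finite_imp_bounded)
  define m where "m = diameter (\<Union>\<S>)"
  have m: "dist u v \<le> m" if "C \<in> \<S>" "u \<in> C" "v \<in> C" for C u v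
    unfolding m_def using diameter_bounded_bound[OF bd, of u v] that by blast
  \<comment> \<open>Fineness is recorded for vertices of a common simplex only, which is all that
    edges require.\<close>
  have "\<exists>\<T>. vertex_complex \<T> \<and> vertex_complex_symmetry \<T> \<tau> \<and>
      \<Union>((hull) convex ` \<T>) = \<Union>((hull) convex ` \<S>) \<and>
      (\<forall>C\<in>\<T>. \<forall>u\<in>C. \<forall>v\<in>C. dist u v \<le> r ^ n * m)" for n
  proof (induction n)
    case 0
    show ?case using vc sym m by (intro exI[of _ \<S>]) auto
  next
    case (Suc n)
    then obtain \<T> where \<T>: "vertex_complex \<T>" "vertex_complex_symmetry \<T> \<tau>"
      "\<Union>((hull) convex ` \<T>) = \<Union>((hull) convex ` \<S>)"
      "\<forall>C\<in>\<T>. \<forall>u\<in>C. \<forall>v\<in>C. dist u v \<le> r ^ n * m" by blast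
    have "dist p q \<le> r * (r ^ n * m)" if "B \<in> barycentric_subdivision \<T>" "p \<in> B" "q \<in> B" for B p q
      using barycentric_subdivision_mesh[OF \<T>(1) _ that] \<T>(4) unfolding r_def by auto
    then show ?case
      using \<T> vertex_complex_barycentric_subdivision[OF \<T>(1)]
        vertex_complex_symmetry_subdivision[OF \<T>(1,2)] Union_hull_barycentric_subdivision[OF \<T>(1)]
      by (intro exI[of _ "barycentric_subdivision \<T>"]) (simp add: mult.assoc)
  qed
  note * = this
  have "(\<lambda>n. r ^ n * m) \<longlonglongrightarrow> 0 * m" using r by (intro tendsto_intros LIMSEQ_power_zero) auto
  then have "\<forall>\<^sub>F n in sequentially. r ^ n * m < e" using e by (intro order_tendstoD(2)) auto
  then obtain n where n: "r ^ n * m < e" by (meson eventually_sequentially order_refl)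
  obtain \<T> where \<T>: "vertex_complex \<T>" "vertex_complex_symmetry \<T> \<tau>"
      "\<Union>((hull) convex ` \<T>) = \<Union>((hull) convex ` \<S>)"
      "\<forall>C\<in>\<T>. \<forall>u\<in>C. \<forall>v\<in>C. dist u v \<le> r ^ n * m" using *[of n] by blast
  have "\<forall>C\<in>\<T>. \<forall>u\<in>C. \<forall>v\<in>C. dist u v < e" using \<T>(4) n by (meson le_less_trans)
  then show ?thesis by (rule that[OF \<T>(1-3)])
qed

lemma vertex_complex_symmetry_continuous:
  fixes \<tau> :: "'a::euclidean_space \<Rightarrow> 'a"
  assumes vc: "vertex_complex \<S>" and sym: "vertex_complex_symmetry \<S> \<tau>"
  shows "continuous_on (\<Union>((hull) convex ` \<S>)) \<tau>"
proof (rule continuous_on_closed_Union[OF vertex_complexD(1)[OF vc]])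
  fix C assume C: "C \<in> \<S>"
  show "closed (convex hull C)"
    using vertex_complexD(2)[OF vc C] by (simp add: compact_imp_closed finite_imp_compact_convex_hull)
  show "continuous_on (convex hull C) \<tau>"
    using C sym affine_map_on_continuous unfolding vertex_complex_symmetry_def by blast
qed

text \<open>A simplicial involution is its own simplicial inverse, so it cannot collapse simplices.\<close>

lemma vertex_complex_symmetry_vertex_sets:
  fixes K :: "'a::euclidean_space set set"
  assumes K: "simplicial_complex K" and \<tau>: "simplicial_map K K \<tau>" "\<And>x. x \<in> \<Union>K \<Longrightarrow> \<tau> (\<tau> x) = x"
  shows "vertex_complex_symmetry (vertex_sets K) \<tau>"
proof -
  note hulls = convex_hulls_vertex_sets[OF K]
  have aff: "affine_map_on (convex hull C) \<tau>" and im: "\<tau> ` (convex hull C) \<in> K" if "C \<in> vertex_sets K" for C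
    using that \<tau>(1) unfolding vertex_sets_def simplicial_map_def by blast+
  have cover: "convex hull C \<subseteq> \<Union>K" if "C \<in> vertex_sets K" for C
    using that unfolding vertex_sets_def by blast
  \<comment> \<open>Extreme points of an affine image come from vertices. That no vertex lands on a
    non-vertex follows by applying the same to \<open>\<tau>\<close> from \<open>D\<close> back to
    \<open>C\<close>.\<close>
  have vertex_image: "D \<subseteq> \<tau> ` C" if "C \<in> vertex_sets K" "D \<in> vertex_sets K" "\<tau> ` (convex hull C) = convex hull D" for C D
  proof
    fix x assume "x \<in> D"
    then have "x extreme_point_of (convex hull D)"
      using extreme_point_of_convex_hull_affine_independent that(2) unfolding vertex_sets_def by blast
    then have "x extreme_point_of (convex hull (\<tau> ` C))"
      using that(3) affine_map_on_hull_image[OF aff[OF that(1)]] by simp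
    then show "x \<in> \<tau> ` C" by (rule extreme_point_of_convex_hull)
  qed
  have "\<tau> ` C \<in> vertex_sets K" if C: "C \<in> vertex_sets K" for C
  proof -
    obtain D where D: "D \<in> vertex_sets K" "\<tau> ` (convex hull C) = convex hull D"
      using im[OF C] hulls by (metis imageE)
    have "\<tau> ` (convex hull D) = (\<lambda>x. \<tau> (\<tau> x)) ` (convex hull C)" by (simp add: image_image flip: D(2))
    also have "\<dots> = (\<lambda>x. x) ` (convex hull C)"
      by (rule image_cong[OF refl]) (use cover[OF C] \<tau>(2) in blast)
    finally have inverse: "\<tau> ` (convex hull D) = convex hull C" by simp
    have "\<tau> ` C \<subseteq> D"
    proof
      fix y assume "y \<in> \<tau> ` C"
      then obtain x where x: "x \<in> C" "y = \<tau> x" by blast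
      then obtain z where z: "z \<in> D" "x = \<tau> z" using vertex_image[OF D(1) C inverse] by blast
      then have "z \<in> \<Union>K" using cover[OF D(1)] hull_inc[of z D convex] by blast
      then show "y \<in> D" using \<tau>(2) x z by simp
    qed
    then have "\<tau> ` C = D" using vertex_image[OF C D] by blast
    then show ?thesis using D(1) by simp
  qed
  moreover have "inj_on \<tau> (\<Union>K)" by (rule inj_on_inverseI[of _ \<tau>]) (rule \<tau>(2))
  ultimately show ?thesis unfolding vertex_complex_symmetry_def hulls using aff by blast
qed

section \<open>Equivariant triangulations of the manifold\<close>

lemma pl_triangulationD:
  assumes "pl_triangulation K h M"
  shows "simplicial_complex K" "bij_betw h (\<Union>K) M" "continuous_on (\<Union>K) h" "continuous_on M (inv_into (\<Union>K) h)"
  using assms unfolding pl_triangulation_def pl_homeomorphism_def piecewise_linear_on_def by blast+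

lemma transport_involution:
  assumes h: "bij_betw h (\<Union>K) M" and A: "free_involution M A" and x: "x \<in> \<Union>K"
  shows "transport K h A x \<in> \<Union>K" "h (transport K h A x) = A (h x)"
    "transport K h A (transport K h A x) = x"
proof -
  have hx: "h x \<in> M" using h x bij_betwE by blast
  then have Ahx: "A (h x) \<in> M" "A (A (h x)) = h x" using A unfolding free_involution_def by blast+
  show 1: "h (transport K h A x) = A (h x)"
    using bij_betw_inv_into_right[OF h Ahx(1)] by (simp add: transport_def)
  show "transport K h A x \<in> \<Union>K"
    using bij_betwE[OF bij_betw_inv_into[OF h]] Ahx(1) by (simp add: transport_def)
  have "transport K h A (transport K h A x) = inv_into (\<Union>K) h (A (h (transport K h A x)))"
    by (simp only: transport_def o_apply)
  also have "\<dots> = inv_into (\<Union>K) h (h x)" unfolding 1 Ahx(2) ..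
  finally show "transport K h A (transport K h A x) = x"
    using bij_betw_inv_into_left[OF h x] by simp
qed

lemma vertex_complex_symmetry_transport:
  fixes K :: "'b::euclidean_space set set"
  assumes T: "pl_triangulation K h M" and A: "free_involution M A" and s: "simplicial_wrt K h A"
  shows "vertex_complex_symmetry (vertex_sets K) (transport K h A)"
  using vertex_complex_symmetry_vertex_sets[OF pl_triangulationD(1)[OF T] s[unfolded simplicial_wrt_def]]
    transport_involution(3)[OF pl_triangulationD(2)[OF T] A] by blast

lemma fine_equivariant_triangulation:
  fixes K :: "'b::euclidean_space set set"
  assumes T: "pl_triangulation K h M" and A: "free_involution M A" and s: "simplicial_wrt K h A"
    and e: "0 < e"
  obtains K' :: "'b set set" where "equivariant_triangulation K' h M A" "\<Union>K' = \<Union>K"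
    "\<And>a b. a \<noteq> b \<Longrightarrow> closed_segment a b \<in> K' \<Longrightarrow> dist a b < e"
proof -
  define \<tau> where "\<tau> = transport K h A"
  note D = pl_triangulationD[OF T]
  have sym: "vertex_complex_symmetry (vertex_sets K) \<tau>"
    using vertex_complex_symmetry_transport[OF T A s] by (simp add: \<tau>_def)
  obtain \<T> where \<T>: "vertex_complex \<T>" "vertex_complex_symmetry \<T> \<tau>"
    "\<Union>((hull) convex ` \<T>) = \<Union>((hull) convex ` vertex_sets K)"
    "\<forall>C\<in>\<T>. \<forall>u\<in>C. \<forall>v\<in>C. dist u v < e"
    using fine_symmetric_vertex_complex[OF vertex_complex_vertex_sets[OF D(1)] sym e] by blast
  define K' where "K' = (hull) convex ` \<T>"
  have U: "\<Union>K' = \<Union>K" using \<T>(3) convex_hulls_vertex_sets[OF D(1)] by (simp add: K'_def)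
  \<comment> \<open>Transport depends on the complex only through its polyhedron.\<close>
  have tr: "transport K' h A = \<tau>" unfolding \<tau>_def transport_def U ..
  have im: "\<tau> ` S \<in> K'" "affine_map_on S \<tau>" if S: "S \<in> K'" for S
  proof -
    obtain C where C: "C \<in> \<T>" "S = convex hull C" using S unfolding K'_def by blast
    then have C': "\<tau> ` C \<in> \<T>" "affine_map_on (convex hull C) \<tau>"
      using \<T>(2) unfolding vertex_complex_symmetry_def by blast+
    then show "affine_map_on S \<tau>" using C by simp
    have "\<tau> ` S = convex hull (\<tau> ` C)" using affine_map_on_hull_image[OF C'(2)] C(2) by simp
    then show "\<tau> ` S \<in> K'" using C'(1) unfolding K'_def by blast
  qed
  have inv: "\<tau> ` \<tau> ` S = S" if "S \<in> K'" for S
  proof -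
    have "\<tau> ` \<tau> ` S = (\<lambda>x. x) ` S" unfolding image_image \<tau>_def
      by (rule image_cong[OF refl]) (use transport_involution(3)[OF D(2) A] that U in blast)
    then show ?thesis by simp
  qed
  have "(\<lambda>S. \<tau> ` S) ` K' = K'"
  proof
    show "(\<lambda>S. \<tau> ` S) ` K' \<subseteq> K'" using im(1) by blast
    show "K' \<subseteq> (\<lambda>S. \<tau> ` S) ` K'" using im(1) inv by (metis image_eqI subsetI)
  qed
  moreover have "simplicial_complex K'" unfolding K'_def by (rule simplicial_complex_convex_hulls[OF \<T>(1)])
  ultimately have equi: "equivariant_triangulation K' h M A"
    using T im unfolding equivariant_triangulation_def simplicial_wrt_def simplicial_map_def tr
      pl_triangulation_def U by blast
  have short: "dist a b < e" if ab: "a \<noteq> b" "closed_segment a b \<in> K'" for a b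
  proof -
    obtain C where C: "C \<in> \<T>" "convex hull C = convex hull {a, b}"
      using ab(2) unfolding K'_def segment_convex_hull by auto
    \<comment> \<open>An edge is given as a segment; its vertex set in \<open>\<T>\<close> is
      recovered from the hull.\<close>
    have "C = {a, b}"
      by (rule affine_independent_hull_inject[OF vertex_complex_affine_independent[OF \<T>(1) C(1)] _ C(2)]) simp
    then show ?thesis using bspec[OF \<T>(4) C(1)] by simp
  qed
  show ?thesis by (rule that[OF equi U short])
qed

subsection \<open>Odd maps and antipodal labellings\<close>

text \<open>Translating one point to the origin turns affine into linear independence; the constant
  then corrects the value at that point.\<close>

lemma affine_independent_extend:
  fixes C :: "'a::euclidean_space set" and \<phi> :: "'a \<Rightarrow> 'b::real_vector"
  assumes "\<not> affine_dependent C"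
  obtains g c where "linear g" "\<forall>v\<in>C. g v + c = \<phi> v"
proof (cases "C = {}")
  case True
  show ?thesis by (rule that[of "\<lambda>_. 0" 0]) (simp_all add: True linear_zero)
next
  case False
  then obtain a where a: "a \<in> C" by blast
  have "independent ((\<lambda>x. - a + x) ` (C - {a}))"
    using assms affine_dependent_iff_dependent2[OF a] by blast
  then obtain g where g: "linear g" "\<forall>y\<in>(\<lambda>x. - a + x) ` (C - {a}). g y = \<phi> (a + y) - \<phi> a"
    using linear_independent_extend[of _ "\<lambda>y. \<phi> (a + y) - \<phi> a"] by blast
  have "g v + (\<phi> a - g a) = \<phi> v" if "v \<in> C" for v
  proof (cases "v = a")
    case False
    then have "g (- a + v) = \<phi> v - \<phi> a" using g(2) that by simp
    then have "g v - g a = \<phi> v - \<phi> a" by (simp add: linear_diff[OF g(1), symmetric])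
    then show ?thesis by (simp add: algebra_simps)
  qed simp
  then show ?thesis using g(1) that by blast
qed

text \<open>Unique coordinates define \<open>F\<close> on the whole polyhedron at once, so agreement
  on common faces is automatic. On each simplex \<open>F\<close> coincides with an affine map, and
  finitely many closed simplices cover the polyhedron.\<close>

lemma vertex_complex_linear_extension:
  fixes \<S> :: "'a::euclidean_space set set" and \<phi> :: "'a \<Rightarrow> real"
  assumes vc: "vertex_complex \<S>"
  shows "\<exists>F. continuous_on (\<Union>((hull) convex ` \<S>)) F \<and>
    (\<forall>C t. C \<in> \<S> \<and> (\<forall>v\<in>C. 0 \<le> t v) \<and> sum t C = 1 \<longrightarrow>
      F (\<Sum>v\<in>C. t v *\<^sub>R v) = (\<Sum>v\<in>C. t v * \<phi> v))"
proof -
  define F where "F = (\<lambda>x. \<Sum>v\<in>\<Union>\<S>. (THE t. barycentric_coords \<S> x t) v * \<phi> v)"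
  have fin: "finite (\<Union>\<S>)" using vertex_complexD(1,2)[OF vc] by auto
  have F: "F (\<Sum>v\<in>C. t v *\<^sub>R v) = (\<Sum>v\<in>C. t v * \<phi> v)"
    if C: "C \<in> \<S>" "\<forall>v\<in>C. 0 \<le> t v" "sum t C = 1" for C t
  proof -
    define s where "s = (\<lambda>v. if v \<in> C then t v else 0)"
    define x where "x = (\<Sum>v\<in>C. t v *\<^sub>R v)"
    have s: "barycentric_coords \<S> x s"
      by (rule barycentric_coordsI[OF C(1)]) (use C in \<open>auto simp: s_def x_def cong: sum.cong\<close>)
    have "(THE t. barycentric_coords \<S> x t) = s"
      by (rule the_equality[where P = "barycentric_coords \<S> x", OF s]) (rule vertex_complexD(4)[OF vc _ s])
    then have "F x = (\<Sum>v\<in>\<Union>\<S>. s v * \<phi> v)" by (simp add: F_def)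
    also have "\<dots> = (\<Sum>v\<in>C. s v * \<phi> v)"
      using C(1) fin by (intro sum.mono_neutral_right) (auto simp: s_def)
    also have "\<dots> = (\<Sum>v\<in>C. t v * \<phi> v)" by (rule sum.cong) (simp_all add: s_def)
    finally show ?thesis by (simp add: x_def)
  qed
  have "continuous_on (\<Union>((hull) convex ` \<S>)) F"
  proof (rule continuous_on_closed_Union[OF vertex_complexD(1)[OF vc]])
    fix C assume C: "C \<in> \<S>"
    have fC: "finite C" using vertex_complexD(2)[OF vc C] .
    show "closed (convex hull C)"
      using fC by (simp add: compact_imp_closed finite_imp_compact_convex_hull)
    obtain g c where g: "linear g" "\<forall>v\<in>C. g v + c = \<phi> v"
      by (rule affine_independent_extend[OF vertex_complex_affine_independent[OF vc C]])
    have "F x = g x + c" if x: "x \<in> convex hull C" for x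
    proof -
      have "x \<in> {y. \<exists>u. (\<forall>v\<in>C. 0 \<le> u v) \<and> sum u C = 1 \<and> (\<Sum>v\<in>C. u v *\<^sub>R v) = y}"
        using x by (simp only: convex_hull_finite[OF fC])
      then obtain u where u: "\<forall>v\<in>C. 0 \<le> u v" "sum u C = 1" "(\<Sum>v\<in>C. u v *\<^sub>R v) = x"
        by auto
      have "F x = (\<Sum>v\<in>C. u v * \<phi> v)" using F[OF C u(1,2)] u(3) by simp
      also have "\<dots> = (\<Sum>v\<in>C. u v * (g v + c))" by (rule sum.cong) (simp_all add: g(2))
      also have "\<dots> = (\<Sum>v\<in>C. u v * g v) + sum u C * c"
        by (simp add: distrib_left sum.distrib sum_distrib_right)
      also have "(\<Sum>v\<in>C. u v * g v) = g x"
        unfolding u(3)[symmetric] by (simp add: linear_sum[OF g(1)] linear_scale[OF g(1)])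
      finally show ?thesis using u(2) by simp
    qed
    moreover have "continuous_on (convex hull C) (\<lambda>x. g x + c)"
      using g(1) by (intro continuous_intros linear_continuous_on) (simp add: linear_linear)
    ultimately show "continuous_on (convex hull C) F" by (simp cong: continuous_on_cong)
  qed
  then show ?thesis using F by (intro exI[of _ F]) simp
qed

text \<open>The vertices of the cross-polytope are \<open>\<plusminus>e\<^sub>i\<close>, indexed from \<open>0\<close>, while labels start at \<open>1\<close>.\<close>

definition cross_polytope_vertex :: "int \<Rightarrow> nat \<Rightarrow> real" where
  "cross_polytope_vertex l i = (if l = int i + 1 then 1 else if l = - (int i + 1) then - 1 else 0)"

lemma cross_polytope_vertex_minus [simp]: "cross_polytope_vertex (- l) i = - cross_polytope_vertex l i"
  unfolding cross_polytope_vertex_def by auto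

lemma not_but_manifold_if_no_complementary_edge:
  fixes K :: "'b::euclidean_space set set" and M :: "'a::euclidean_space set"
  assumes T: "pl_triangulation K h M" and A: "free_involution M A" and s: "simplicial_wrt K h A"
    and L: "antipodal_labelling d (tri_vertices K h) A L"
    and no_edge: "\<And>u v. tri_edge K h u v \<Longrightarrow> L u \<noteq> - L v"
  shows "\<not> but_manifold d M A"
proof
  assume but: "but_manifold d M A"
  define \<S> where "\<S> = vertex_sets K"
  define \<tau> where "\<tau> = transport K h A"
  note D = pl_triangulationD[OF T]
  have vc: "vertex_complex \<S>" unfolding \<S>_def by (rule vertex_complex_vertex_sets[OF D(1)])
  have U: "(hull) convex ` \<S> = K" unfolding \<S>_def by (rule convex_hulls_vertex_sets[OF D(1)])
  have sym: "vertex_complex_symmetry \<S> \<tau>"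
    unfolding \<S>_def \<tau>_def by (rule vertex_complex_symmetry_transport[OF T A s])
  have vertex: "v \<in> \<Union>K" "h v \<in> tri_vertices K h" if C: "C \<in> \<S>" "v \<in> C" for C v
  proof -
    have "{v} \<in> \<S>" using vertex_complexD(3)[OF vc C(1), of "{v}"] C(2) by simp
    then have "{v} \<in> K" using U by (metis convex_hull_singleton imageI)
    then show "v \<in> \<Union>K" "h v \<in> tri_vertices K h" unfolding tri_vertices_def by auto
  qed
  have lab: "1 \<le> \<bar>L (h v)\<bar>" "\<bar>L (h v)\<bar> \<le> int d" "L (h (\<tau> v)) = - L (h v)" if C: "C \<in> \<S>" "v \<in> C" for C v
    using L vertex[OF C] transport_involution(2)[OF D(2) A vertex(1)[OF C]]
    unfolding antipodal_labelling_def \<tau>_def by auto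
  have "\<forall>i. \<exists>F. continuous_on (\<Union>K) F \<and>
    (\<forall>C t. C \<in> \<S> \<and> (\<forall>v\<in>C. 0 \<le> t v) \<and> sum t C = 1 \<longrightarrow>
      F (\<Sum>v\<in>C. t v *\<^sub>R v) = (\<Sum>v\<in>C. t v * cross_polytope_vertex (L (h v)) i))"
    using vertex_complex_linear_extension[OF vc] unfolding U by (rule allI)
  from choice[OF this] obtain F where "\<forall>i. continuous_on (\<Union>K) (F i) \<and>
    (\<forall>C t. C \<in> \<S> \<and> (\<forall>v\<in>C. 0 \<le> t v) \<and> sum t C = 1 \<longrightarrow>
      F i (\<Sum>v\<in>C. t v *\<^sub>R v) = (\<Sum>v\<in>C. t v * cross_polytope_vertex (L (h v)) i))" ..
  then have F: "continuous_on (\<Union>K) (F i)"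
    "C \<in> \<S> \<Longrightarrow> \<forall>v\<in>C. 0 \<le> t v \<Longrightarrow> sum t C = 1 \<Longrightarrow>
      F i (\<Sum>v\<in>C. t v *\<^sub>R v) = (\<Sum>v\<in>C. t v * cross_polytope_vertex (L (h v)) i)" for i C t
    by simp_all
  have coords: "\<exists>C t. C \<in> \<S> \<and> (\<forall>v\<in>C. 0 \<le> t v) \<and> sum t C = 1 \<and> (\<Sum>v\<in>C. t v *\<^sub>R v) = x"
    if x: "x \<in> \<Union>K" for x
  proof -
    have "x \<in> \<Union>((hull) convex ` \<S>)" using x by (simp only: U)
    then obtain C where C: "C \<in> \<S>" "x \<in> convex hull C" by auto
    have fC: "finite C" using vertex_complexD(2)[OF vc C(1)] .
    have "x \<in> {y. \<exists>u. (\<forall>v\<in>C. 0 \<le> u v) \<and> sum u C = 1 \<and> (\<Sum>v\<in>C. u v *\<^sub>R v) = y}"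
      using C(2) by (simp only: convex_hull_finite[OF fC])
    then show ?thesis using C(1) by auto
  qed
  have odd: "F i (\<tau> x) = - F i x" if x: "x \<in> \<Union>K" for i x
  proof -
    obtain C t where C: "C \<in> \<S>" "\<forall>v\<in>C. 0 \<le> t v" "sum t C = 1" "(\<Sum>v\<in>C. t v *\<^sub>R v) = x"
      using coords[OF x] by blast
    have fC: "finite C" using vertex_complexD(2)[OF vc C(1)] .
    have C': "\<tau> ` C \<in> \<S>" "affine_map_on (convex hull C) \<tau>"
      using sym C(1) unfolding vertex_complex_symmetry_def by blast+
    have inv: "\<tau> (\<tau> v) = v" if "v \<in> C" for v
      using transport_involution(3)[OF D(2) A vertex(1)[OF C(1) that]] by (simp add: \<tau>_def)
    have inj: "inj_on \<tau> C" by (rule inj_on_inverseI[of _ \<tau>]) (rule inv)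
    have "\<tau> x = (\<Sum>v\<in>C. t v *\<^sub>R \<tau> v)"
      using affine_map_on_convex_combination[OF C'(2) fC C(2,3)] C(4) by simp
    \<comment> \<open>The coordinates of the image point are those of \<open>x\<close> moved along
      \<open>\<tau>\<close>, its own inverse.\<close>
    also have "\<dots> = (\<Sum>w\<in>\<tau> ` C. t (\<tau> w) *\<^sub>R w)" by (simp add: sum.reindex[OF inj] inv)
    finally have "F i (\<tau> x) = (\<Sum>w\<in>\<tau> ` C. t (\<tau> w) * cross_polytope_vertex (L (h w)) i)"
      using F(2)[OF C'(1), of "\<lambda>w. t (\<tau> w)" i] C(2,3) by (simp add: sum.reindex[OF inj] inv)
    also have "\<dots> = (\<Sum>v\<in>C. - (t v * cross_polytope_vertex (L (h v)) i))"
      unfolding sum.reindex[OF inj] by (rule sum.cong) (simp_all add: inv lab(3)[OF C(1)])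
    also have "\<dots> = - F i x" using F(2)[OF C(1-3)] C(4) by (simp add: sum_negf)
    finally show ?thesis .
  qed
  have nonzero: "\<exists>i<d. F i x \<noteq> 0" if x: "x \<in> \<Union>K" for x
  proof -
    obtain C t where C: "C \<in> \<S>" "\<forall>v\<in>C. 0 \<le> t v" "sum t C = 1" "(\<Sum>v\<in>C. t v *\<^sub>R v) = x"
      using coords[OF x] by blast
    have fC: "finite C" using vertex_complexD(2)[OF vc C(1)] .
    have "\<not> (\<forall>v\<in>C. t v = 0)" using C(3) by (metis sum.neutral zero_neq_one)
    then obtain v where v: "v \<in> C" "t v > 0" using C(2) by (metis less_eq_real_def)
    define l where "l = L (h v)"
    have l: "1 \<le> \<bar>l\<bar>" "\<bar>l\<bar> \<le> int d" using lab[OF C(1) v(1)] by (simp_all add: l_def)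
    \<comment> \<open>The axis of the label of a vertex with positive weight. No vertex of
      \<open>C\<close> has label \<open>- l\<close>, so along this axis nothing can cancel the
      contribution of \<open>v\<close>.\<close>
    define i where "i = nat (\<bar>l\<bar> - 1)"
    have i: "i < d" "int i + 1 = \<bar>l\<bar>" using l by (auto simp: i_def)
    have "L (h w) \<noteq> - l" if w: "w \<in> C" for w
    proof (cases "w = v")
      case True then show ?thesis using l by (auto simp: l_def)
    next
      case False
      have "{v, w} \<in> \<S>" using vertex_complexD(3)[OF vc C(1), of "{v, w}"] v w by simp
      then have "closed_segment v w \<in> K" using U by (metis segment_convex_hull imageI)
      then have "tri_edge K h (h v) (h w)"
        unfolding tri_edge_def using False by (intro exI[of _ v] exI[of _ w]) simp
      from no_edge[OF this] show ?thesis by (auto simp: l_def)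
    qed
    then have sgn: "0 \<le> of_int (sgn l) * cross_polytope_vertex (L (h w)) i" if "w \<in> C" for w
      using that i(2) unfolding cross_polytope_vertex_def by (auto simp: abs_if split: if_splits)
    have "of_int (sgn l) * cross_polytope_vertex l i = 1"
      using i(2) l unfolding cross_polytope_vertex_def by (auto simp: abs_if split: if_splits)
    then have "t v = t v * (of_int (sgn l) * cross_polytope_vertex (L (h v)) i)" by (simp add: l_def)
    also have "\<dots> \<le> (\<Sum>w\<in>C. t w * (of_int (sgn l) * cross_polytope_vertex (L (h w)) i))"
      by (rule member_le_sum[OF v(1) _ fC]) (use C(2) sgn in \<open>auto intro!: mult_nonneg_nonneg\<close>)
    also have "\<dots> = of_int (sgn l) * F i x"
      using F(2)[OF C(1-3)] C(4) by (simp add: sum_distrib_left mult.left_commute)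
    finally have "F i x \<noteq> 0" using v(2) by auto
    then show ?thesis using i(1) by blast
  qed
  define inv where "inv = inv_into (\<Union>K) h"
  \<comment> \<open>Points of \<open>Euclidean_space d\<close> are sequences that vanish from index
    \<open>d\<close> on.\<close>
  define g where "g = (\<lambda>y i. if i < d then F i (inv y) else 0)"
  have invM: "inv y \<in> \<Union>K" if "y \<in> M" for y
    using bij_betwE[OF bij_betw_inv_into[OF D(2)]] that by (simp add: inv_def)
  have "continuous_on M (\<lambda>y. F i (inv y))" for i
    by (rule continuous_on_compose2[OF F(1)]) (use D(4) invM in \<open>auto simp: inv_def\<close>)
  then have "continuous_map (top_of_set M) (Euclidean_space d) g"
    unfolding g_def continuous_map_componentwise_Euclidean_space by simp
  then obtain y where y: "y \<in> M" "g (A y) = g y" using but unfolding but_manifold_def by blast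
  have "h (inv y) = y" using bij_betw_inv_into_right[OF D(2) y(1)] by (simp add: inv_def)
  then have "inv (A y) = \<tau> (inv y)" by (simp add: \<tau>_def transport_def inv_def)
  \<comment> \<open>The value at \<open>A y\<close> is both equal and opposite to the value at
    \<open>y\<close>.\<close>
  then have "F i (inv y) = 0" if "i < d" for i
    using fun_cong[OF y(2), of i] odd[OF invM[OF y(1)], of i] that by (simp add: g_def)
  then show False using nonzero[OF invM[OF y(1)]] by blast
qed

lemma but_manifold_if_complementary_edges:
  fixes K :: "'b::euclidean_space set set" and M :: "'a::euclidean_space set"
  assumes T: "pl_triangulation K h M" and A: "free_involution M A" and s: "simplicial_wrt K h A"
    and M: "compact M"
    and edge: "\<And>K' L. equivariant_triangulation (K' :: 'b set set) h M A \<Longrightarrow>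
      antipodal_labelling d (tri_vertices K' h) A L \<Longrightarrow> \<exists>u v. tri_edge K' h u v \<and> L u = - L v"
  shows "but_manifold d M A"
  unfolding but_manifold_def
proof (intro allI impI, rule ccontr)
  fix g assume g: "continuous_map (top_of_set M) (Euclidean_space d) g" and "\<not> (\<exists>x\<in>M. g (A x) = g x)"
  then have ne: "g (A x) \<noteq> g x" if "x \<in> M" for x using that by blast
  define \<tau> where "\<tau> = transport K h A"
  note D = pl_triangulationD[OF T]
  have U: "(hull) convex ` vertex_sets K = K" by (rule convex_hulls_vertex_sets[OF D(1)])
  have \<tau>: "continuous_on (\<Union>K) \<tau>"
    using vertex_complex_symmetry_continuous[OF vertex_complex_vertex_sets[OF D(1)]
        vertex_complex_symmetry_transport[OF T A s]] by (simp add: U \<tau>_def)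
  have hM: "h x \<in> M" if "x \<in> \<Union>K" for x using bij_betwE[OF D(2)] that by blast
  have \<tau>K: "\<tau> x \<in> \<Union>K" "h (\<tau> x) = A (h x)" if "x \<in> \<Union>K" for x
    using transport_involution(1,2)[OF D(2) A that] by (simp_all add: \<tau>_def)
  have AM: "A y \<in> M" "A (A y) = y" if "y \<in> M" for y using A that unfolding free_involution_def by auto
  define f where "f = (\<lambda>y i. g y i - g (A y) i)"
  have fA: "f (A y) i = - f y i" if "y \<in> M" for y i using AM[OF that] by (simp add: f_def)
  have gi: "continuous_on M (\<lambda>y. g y i)" for i
    using g unfolding Euclidean_space_def continuous_map_in_subtopology continuous_map_componentwise_UNIV
    by simp
  have gd: "g y i = 0" if "y \<in> M" "d \<le> i" for y i
    using continuous_map_image_subset_topspace[OF g] that by (auto simp: topspace_Euclidean_space)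
  have h\<tau>: "continuous_on (\<Union>K) (\<lambda>x. h (\<tau> x))"
    by (rule continuous_on_compose2[OF D(3) \<tau>]) (use \<tau>K(1) in blast)
  have "continuous_on (\<Union>K) (\<lambda>x. g (h x) i)" for i
    by (rule continuous_on_compose2[OF gi D(3)]) (use hM in blast)
  moreover have "continuous_on (\<Union>K) (\<lambda>x. g (h (\<tau> x)) i)" for i
    by (rule continuous_on_compose2[OF gi h\<tau>]) (use hM \<tau>K(1) in blast)
  ultimately have "continuous_on (\<Union>K) (\<lambda>x. g (h x) i - g (h (\<tau> x)) i)" for i
    by (intro continuous_on_diff)
  then have fc: "continuous_on (\<Union>K) (\<lambda>x. f (h x) i)" for i
    by (rule continuous_on_eq) (simp add: f_def \<tau>K)
  have "\<Union>K = inv_into (\<Union>K) h ` M" using bij_betw_imp_surj_on[OF bij_betw_inv_into[OF D(2)]] by simp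
  then have cK: "compact (\<Union>K)" using compact_continuous_image[OF D(4) M] by simp
  obtain \<delta> where \<delta>: "\<delta> > 0" "\<And>x. x \<in> \<Union>K \<Longrightarrow> \<exists>i<d. \<delta> \<le> \<bar>f (h x) i\<bar>"
  proof (cases "\<Union>K = {}")
    case True then show ?thesis using that[of 1] by auto
  next
    case False
    have "continuous_on (\<Union>K) (\<lambda>x. \<Sum>i<d. \<bar>f (h x) i\<bar>)" by (intro continuous_intros fc)
    then obtain x0 where x0: "x0 \<in> \<Union>K" "\<forall>x\<in>\<Union>K. (\<Sum>i<d. \<bar>f (h x0) i\<bar>) \<le> (\<Sum>i<d. \<bar>f (h x) i\<bar>)"
      using continuous_attains_inf[OF cK False] by blast
    define m where "m = (\<Sum>i<d. \<bar>f (h x0) i\<bar>)"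
    obtain j where "g (A (h x0)) j \<noteq> g (h x0) j" using ne[OF hM[OF x0(1)]] by blast
    then have "j < d" "f (h x0) j \<noteq> 0" using gd[OF hM[OF x0(1)]] gd[OF AM(1)[OF hM[OF x0(1)]]]
      unfolding f_def by (metis linorder_not_less, simp)
    then have "0 < \<bar>f (h x0) j\<bar>" "\<bar>f (h x0) j\<bar> \<le> m"
      unfolding m_def by (auto intro!: member_le_sum)
    then have m: "m > 0" by linarith
    \<comment> \<open>If all \<open>d\<close> coordinates were below this bound, their sum would be
      at most \<open>d * m / (d + 1)\<close>, strictly less than the minimum
      \<open>m\<close>.\<close>
    have "\<exists>i<d. m / (real d + 1) \<le> \<bar>f (h x) i\<bar>" if "x \<in> \<Union>K" for x
    proof (rule ccontr)
      assume "\<not> ?thesis"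
      then have "(\<Sum>i<d. \<bar>f (h x) i\<bar>) \<le> (\<Sum>i<d. m / (real d + 1))" by (intro sum_mono) force
      also have "\<dots> = real d * (m / (real d + 1))" by simp
      also have "\<dots> < m" using m by (simp add: field_simps)
      finally show False using x0(2) that by (force simp: m_def)
    qed
    then show ?thesis using that[of "m / (real d + 1)"] m by simp
  qed
  have "\<exists>e>0. \<forall>x\<in>\<Union>K. \<forall>y\<in>\<Union>K. dist x y < e \<longrightarrow> \<bar>f (h x) i - f (h y) i\<bar> < \<delta>" for i
    using compact_uniformly_continuous[OF fc cK, of i] \<delta>(1)
    unfolding uniformly_continuous_on_def dist_real_def by (metis abs_minus_commute dist_commute)
  then obtain E where E: "\<And>i. E i > 0"
    "\<And>i x y. x \<in> \<Union>K \<Longrightarrow> y \<in> \<Union>K \<Longrightarrow> dist x y < E i \<Longrightarrow> \<bar>f (h x) i - f (h y) i\<bar> < \<delta>"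
    by metis
  \<comment> \<open>The inserted 1 keeps the set nonempty when \<open>d\<close> is 0.\<close>
  define e where "e = Min (insert 1 (E ` {..<d}))"
  have e: "e > 0" "\<And>i. i < d \<Longrightarrow> e \<le> E i" using E(1) by (auto simp: e_def)
  obtain K' :: "'b set set" where K': "equivariant_triangulation K' h M A" "\<Union>K' = \<Union>K"
    "\<And>a b. a \<noteq> b \<Longrightarrow> closed_segment a b \<in> K' \<Longrightarrow> dist a b < e"
    by (rule fine_equivariant_triangulation[OF T A s e(1)]) blast
  \<comment> \<open>The choice looks only at absolute values, so \<open>A\<close> preserves it while
    the sign in the label flips.\<close>
  define k where "k = (\<lambda>y. LEAST i. i < d \<and> \<delta> \<le> \<bar>f y i\<bar>)"
  define L where "L = (\<lambda>y. if 0 \<le> f y (k y) then int (k y) + 1 else - (int (k y) + 1))"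
  have k: "k y < d" "\<delta> \<le> \<bar>f y (k y)\<bar>" if y: "y \<in> M" for y
  proof -
    obtain x where "x \<in> \<Union>K" "y = h x" using D(2) y unfolding bij_betw_def by blast
    then have "\<exists>i<d. \<delta> \<le> \<bar>f y i\<bar>" using \<delta>(2) by blast
    from LeastI_ex[OF this] show "k y < d" "\<delta> \<le> \<bar>f y (k y)\<bar>" unfolding k_def by blast+
  qed
  have kA: "k (A y) = k y" if "y \<in> M" for y using that by (simp add: k_def fA)
  \<comment> \<open>At a value 0 both \<open>y\<close> and \<open>A y\<close> would get the positive
    label; the bound \<open>\<delta>\<close> excludes this.\<close>
  have LA: "L (A y) = - L y" if "y \<in> M" for y
    using k[OF that] \<delta>(1) by (auto simp: L_def kA[OF that] fA[OF that])
  have "1 \<le> \<bar>L y\<bar>" "\<bar>L y\<bar> \<le> int d" if "y \<in> M" for y using k(1)[OF that] by (auto simp: L_def)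
  moreover have "y \<in> M" if y: "y \<in> tri_vertices K' h" for y
  proof -
    obtain v where v: "{v} \<in> K'" "y = h v" using y unfolding tri_vertices_def by auto
    then have "v \<in> \<Union>K" using K'(2) by blast
    then show ?thesis using hM v(2) by simp
  qed
  ultimately have "antipodal_labelling d (tri_vertices K' h) A L"
    using LA unfolding antipodal_labelling_def by simp
  from edge[OF K'(1) this] obtain u v where "tri_edge K' h u v" and uv: "L u = - L v" by auto
  then obtain a b where ab: "a \<noteq> b" "closed_segment a b \<in> K'" "u = h a" "v = h b"
    unfolding tri_edge_def by auto
  have "a \<in> \<Union>K'" "b \<in> \<Union>K'" by (rule UnionI[OF ab(2)], simp)+
  then have abK: "a \<in> \<Union>K" "b \<in> \<Union>K" using K'(2) by simp_all
  then have uM: "u \<in> M" "v \<in> M" using hM ab by auto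
  \<comment> \<open>The size of a label determines the coordinate, so both ends are compared in the
    same one, where one value is at least \<open>\<delta>\<close> and the other at most
    \<open>- \<delta>\<close>.\<close>
  have "k u = k v" "0 \<le> f u (k u) \<longleftrightarrow> \<not> 0 \<le> f v (k v)"
    using uv unfolding L_def by (auto split: if_splits)
  then have "2 * \<delta> \<le> \<bar>f u (k u) - f v (k u)\<bar>" using k(2)[OF uM(1)] k(2)[OF uM(2)] by auto
  moreover have "\<bar>f u (k u) - f v (k u)\<bar> < \<delta>"
    using E(2)[OF abK] K'(3)[OF ab(1,2)] e(2)[OF k(1)[OF uM(1)]] ab(3,4) by force
  ultimately show False using \<delta>(1) by linarith
qed

theorem theorem4p1:
  fixes M :: "'a::euclidean_space set" and A :: "'a \<Rightarrow> 'a" and d :: nat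
  assumes "closed_pl_manifold d M"
    and "free_involution M A"
    and "\<exists>(K :: 'b::euclidean_space set set) h. pl_triangulation K h M \<and> simplicial_wrt K h A"
  shows "but_manifold d M A \<longleftrightarrow>
    (\<forall>(K :: 'b set set) h. equivariant_triangulation K h M A \<longrightarrow>
      (\<forall>L. antipodal_labelling d (tri_vertices K h) A L \<longrightarrow>
        (\<exists>u v. tri_edge K h u v \<and> L u = - L v)))"
proof (intro iffI allI impI)
  fix K :: "'b set set" and h L
  assume but: "but_manifold d M A" and K: "equivariant_triangulation K h M A"
    and L: "antipodal_labelling d (tri_vertices K h) A L"
  show "\<exists>u v. tri_edge K h u v \<and> L u = - L v"
    using not_but_manifold_if_no_complementary_edge[OF _ assms(2) _ L] K but
    unfolding equivariant_triangulation_def by blast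
next
  assume edge: "\<forall>(K :: 'b set set) h. equivariant_triangulation K h M A \<longrightarrow>
      (\<forall>L. antipodal_labelling d (tri_vertices K h) A L \<longrightarrow>
        (\<exists>u v. tri_edge K h u v \<and> L u = - L v))"
  \<comment> \<open>Its subdivisions lie in the same ambient space, so the quantifier over complexes
    of type \<open>'b\<close> reaches them.\<close>
  obtain K :: "'b set set" and h where K: "pl_triangulation K h M" "simplicial_wrt K h A"
    using assms(3) by blast
  have "compact M" using assms(1) by (simp add: closed_pl_manifold_def)
  then show "but_manifold d M A"
    by (rule but_manifold_if_complementary_edges[OF K(1) assms(2) K(2)]) (use edge in blast)
qed

end
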